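(* Let $(X,d,\mu)$ be a complete, connected metric measure space equipped with a doubling measure. Let $0<s<1$. Let $A\subset X$ be $s$-thin at $x\in\overline A\setminus A$ with $C_{s,1}(\{x\})>0$. Then for all $0<R_0<\frac14\operatorname{diam}X$, there exists an $s$-superminimizer $u$ in $B(x,R_0)$ such that $$\lim_{A\ni y\to x}u^\wedge(y)=\infty>u^\vee(x).$$
   Context: A metric measure space $(X,d,\mu)$ is a nonempty separable metric space $(X,d)$ with a locally finite Borel-regular outer measure $\mu$ on $X$. $B(x,r)$ is the open ball with center $x$ and radius $r>0$. It is equipped with a doubling measure if there is a doubling constant $C_\mu>0$ such that $0<\mu(B(x,r))<\infty$ and $\mu(B(x,2r))\le C_\mu\mu(B(x,r))$ for all balls $B(x,r)$. Write $B_{x,y}:=B(x,d(x,y))\cup B(y,d(x,y))$ and $\Omega^c:=X\setminus\Omega$. For an open set $\Omega\subset X$ and measurable $u:\Omega\to[-\infty,\infty]$ let $$\|u\|_{\dot W^{s,1}(\Omega)}:=\int_\Omega\int_\Omega\frac{|u(x)-u(y)|}{\mu(B_{x,y})d(x,y)^s}\,d\mu(x)\,d\mu(y),\qquad \|u\|_{W^{s,1}(\Omega)}:=\|u\|_{L^1(\Omega)}+\|u\|_{\dot W^{s,1}(\Omega)};$$ $\dot W^{s,1}(\Omega)$ and $W^{s,1}(\Omega)$ are the spaces of measurable functions on $\Omega$ for which the respective quantity is finite. $W^{s,1}_0(\Omega)$ is the set of $u\in W^{s,1}(X)$ with $u=0$ a.e. on $\Omega^c$. For measurable functions $u,v$ on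 $X$ let $$F(u,v):=\left(\int_\Omega\int_\Omega+2\int_\Omega\int_{\Omega^c}\right)\frac{|u(x)-u(y)|-|v(x)-v(y)|}{\mu(B_{x,y})d(x,y)^s}\,d\mu(x)\,d\mu(y).$$ A measurable function $u:X\to[-\infty,\infty]$ is an $s$-superminimizer in $\Omega$ if $u\in\dot W^{s,1}(\Omega)$ and $F(u,u+\eta)\le 0$ for every nonnegative $\eta\in W^{s,1}_0(\Omega)$. The lower and upper approximate limits of $u:X\to[-\infty,\infty]$ at $x\in X$ are $$u^\wedge(x):=\sup\left\{t\in\mathbb R:\lim_{r\to0^+}\frac{\mu(\{y\in B(x,r):u(y)<t\})}{\mu(B(x,r))}=0\right\},$$ $$u^\vee(x):=\inf\left\{t\in\mathbb R:\lim_{r\to0^+}\frac{\mu(\{y\in B(x,r):u(y)>t\})}{\mu(B(x,r))}=0\right\}.$$ The $(s,1)$-capacity of $A\subset X$ is $C_{s,1}(A):=\inf\|u\|_{W^{s,1}(X)}$ over all $u\in W^{s,1}(X)$ with $u\equiv1$ in a neighbourhood of $A$. $A\Subset F$ means $\overline A$ is a compact subset of $F$. For a bounded set $A$ and a bounded open set $F$ with $A\Subset F$, the condenser capacity is $\operatorname{cap}_{s,1}(A,F):=\inf\|u\|_{\dot W^{s,1}(X)}$ over all $u\in\dot W^{s,1}(X)$ with $u\equiv1$ in a neighbourhood of $A$ and $\operatorname{spt}u:=\overline{\{u\ne0\}}\subset F$. A set $A\subset X$ is $s$-thin at $x\in X$ if $$\lim_{r\to0^+}\frac{\operatorname{cap}_{s,1}(A\cap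 B(x,r),B(x,2r))}{\operatorname{cap}_{s,1}(B(x,r),B(x,2r))}=0.$$ *)

theory Defs
  imports "HOL-Analysis.Analysis"
begin

section \<open>Metric measure spaces\<close>

text \<open>
  The space \<open>X\<close> is a type of class \<open>polish_space\<close> (a complete separable metric space), and \<open>\<mu>\<close> is an
  outer measure defined on all of its subsets.  \<open>lambda_system UNIV UNIV \<mu>\<close> is the
  Caratheodory sigma-algebra of the \<open>\<mu>\<close>-measurable sets.
\<close>

definition borel_regular_outer_measure :: "('a::topological_space set \<Rightarrow> ennreal) \<Rightarrow> bool" where
  "borel_regular_outer_measure \<mu> \<longleftrightarrow>
     outer_measure_space UNIV \<mu> \<and>
     sets borel \<subseteq> lambda_system UNIV UNIV \<mu> \<and>
     (\<forall>A. \<exists>B\<in>sets borel. A \<subseteq> B \<and> \<mu> B = \<mu> A)"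

definition locally_finite_measure :: "('a::metric_space set \<Rightarrow> ennreal) \<Rightarrow> bool" where
  "locally_finite_measure \<mu> \<longleftrightarrow> (\<forall>x. \<exists>r>0. \<mu> (ball x r) < \<infinity>)"

definition doubling_measure :: "('a::metric_space set \<Rightarrow> ennreal) \<Rightarrow> bool" where
  "doubling_measure \<mu> \<longleftrightarrow>
     (\<exists>C>0. \<forall>x r. r > 0 \<longrightarrow>
        0 < \<mu> (ball x r) \<and> \<mu> (ball x r) < \<infinity> \<and> \<mu> (ball x (2 * r)) \<le> ennreal C * \<mu> (ball x r))"

definition induced_measure :: "('a set \<Rightarrow> ennreal) \<Rightarrow> 'a measure" where
  "induced_measure \<mu> = measure_of UNIV (lambda_system UNIV UNIV \<mu>) \<mu>"

lemma space_induced_measure [simp]: "space (induced_measure \<mu>) = UNIV"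
  by (simp add: induced_measure_def space_measure_of_conv)

lemma induced_measure_space:
  assumes "outer_measure_space UNIV \<mu>"
  shows "measure_space UNIV (lambda_system UNIV UNIV \<mu>) \<mu>"
proof -
  interpret sigma_algebra UNIV "UNIV :: 'a set set"
    using sigma_algebra_Pow[of "UNIV :: 'a set"] by simp
  show ?thesis
    using assms by (rule caratheodory_lemma)
qed

lemma sets_induced_measure:
  assumes "outer_measure_space UNIV \<mu>"
  shows "sets (induced_measure \<mu>) = lambda_system UNIV UNIV \<mu>"
proof -
  have "sigma_algebra UNIV (lambda_system UNIV UNIV \<mu>)"
    using induced_measure_space[OF assms] by (simp add: measure_space_def)
  then show ?thesis
    by (simp add: induced_measure_def sets_measure_of_conv sigma_algebra.sigma_sets_eq)
qed

lemma emeasure_induced_measure: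
  assumes "outer_measure_space UNIV \<mu>" and "A \<in> lambda_system UNIV UNIV \<mu>"
  shows "emeasure (induced_measure \<mu>) A = \<mu> A"
proof -
  have "measure_space UNIV (lambda_system UNIV UNIV \<mu>) \<mu>"
    by (rule induced_measure_space[OF assms(1)])
  then show ?thesis
    using assms(2)
    by (auto simp: induced_measure_def measure_space_def intro!: emeasure_measure_of_sigma)
qed

text \<open>Unlike \<open>diameter\<close>, this takes the value \<open>\<infinity>\<close> on unbounded sets.\<close>

definition ediameter :: "'a::metric_space set \<Rightarrow> ereal" where
  "ediameter S = (SUP (x, y) \<in> S \<times> S. ereal (dist x y))"


section \<open>Fractional Sobolev spaces\<close>

definition ball_pair :: "'a::metric_space \<Rightarrow> 'a \<Rightarrow> 'a set" where
  "ball_pair x y = ball x (dist x y) \<union> ball y (dist x y)"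

definition frac_weight :: "('a::metric_space set \<Rightarrow> ennreal) \<Rightarrow> real \<Rightarrow> 'a \<Rightarrow> 'a \<Rightarrow> ennreal" where
  "frac_weight \<mu> s x y = \<mu> (ball_pair x y) * ennreal (dist x y powr s)"

text \<open>
  In \<^typ>\<open>ereal\<close>, \<open>\<bar>u x - u y\<bar> = \<infinity>\<close> also when \<open>u x\<close> and \<open>u y\<close> are infinite of the same sign.
  On the diagonal the weight vanishes, and \<open>0 / 0 = 0\<close>.
\<close>

definition frac_seminorm ::
    "('a::metric_space set \<Rightarrow> ennreal) \<Rightarrow> real \<Rightarrow> 'a set \<Rightarrow> ('a \<Rightarrow> ereal) \<Rightarrow> ennreal" where
  "frac_seminorm \<mu> s \<Omega> u =
     (\<integral>\<^sup>+y\<in>\<Omega>. (\<integral>\<^sup>+x\<in>\<Omega>. (e2ennreal \<bar>u x - u y\<bar> / frac_weight \<mu> s x y)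
        \<partial>induced_measure \<mu>) \<partial>induced_measure \<mu>)"

definition frac_norm ::
    "('a::metric_space set \<Rightarrow> ennreal) \<Rightarrow> real \<Rightarrow> 'a set \<Rightarrow> ('a \<Rightarrow> ereal) \<Rightarrow> ennreal" where
  "frac_norm \<mu> s \<Omega> u =
     (\<integral>\<^sup>+x\<in>\<Omega>. e2ennreal \<bar>u x\<bar> \<partial>induced_measure \<mu>) + frac_seminorm \<mu> s \<Omega> u"

text \<open>
  A function on \<open>\<Omega>\<close> is represented by a function on the whole space of which only the
  restriction to \<open>\<Omega>\<close> matters.
\<close>

definition frac_hom_sobolev ::
    "('a::metric_space set \<Rightarrow> ennreal) \<Rightarrow> real \<Rightarrow> 'a set \<Rightarrow> ('a \<Rightarrow> ereal) set" where
  "frac_hom_sobolev \<mu> s \<Omega> =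
     {u \<in> borel_measurable (restrict_space (induced_measure \<mu>) \<Omega>). frac_seminorm \<mu> s \<Omega> u < \<infinity>}"

definition frac_sobolev ::
    "('a::metric_space set \<Rightarrow> ennreal) \<Rightarrow> real \<Rightarrow> 'a set \<Rightarrow> ('a \<Rightarrow> ereal) set" where
  "frac_sobolev \<mu> s \<Omega> =
     {u \<in> borel_measurable (restrict_space (induced_measure \<mu>) \<Omega>). frac_norm \<mu> s \<Omega> u < \<infinity>}"

definition frac_sobolev_zero ::
    "('a::metric_space set \<Rightarrow> ennreal) \<Rightarrow> real \<Rightarrow> 'a set \<Rightarrow> ('a \<Rightarrow> ereal) set" where
  "frac_sobolev_zero \<mu> s \<Omega> =
     {u \<in> frac_sobolev \<mu> s UNIV. AE x in induced_measure \<mu>. x \<in> - \<Omega> \<longrightarrow> u x = 0}"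


section \<open>Superminimizers\<close>

text \<open>
  The Lebesgue integral of an extended real function, as the integral of the positive part
  minus the integral of the negative part (\<^const>\<open>e2ennreal\<close> truncates at \<open>0\<close>).  An undefined
  value \<open>\<infinity> - \<infinity>\<close> is \<open>\<infinity>\<close>.
\<close>

definition ext_set_integral :: "'a measure \<Rightarrow> 'a set \<Rightarrow> ('a \<Rightarrow> ereal) \<Rightarrow> ereal" where
  "ext_set_integral M S f =
     enn2ereal (\<integral>\<^sup>+x\<in>S. e2ennreal (f x) \<partial>M) - enn2ereal (\<integral>\<^sup>+x\<in>S. e2ennreal (- f x) \<partial>M)"

text \<open>
  Wherever the integrand or the integral has the form \<open>\<infinity> - \<infinity>\<close>, \<^typ>\<open>ereal\<close> assigns it the value \<open>\<infinity>\<close>,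
  so that an ill-defined functional never satisfies the inequality in the definition of
  superminimizers.  If \<open>u\<close> is finite almost everywhere and \<open>\<eta> \<in> frac_sobolev_zero \<mu> s \<Omega>\<close>, then
  the integrals for \<open>v = u + \<eta>\<close> converge absolutely.
\<close>

definition frac_functional ::
    "('a::metric_space set \<Rightarrow> ennreal) \<Rightarrow> real \<Rightarrow> 'a set \<Rightarrow> ('a \<Rightarrow> ereal) \<Rightarrow> ('a \<Rightarrow> ereal) \<Rightarrow> ereal" where
  "frac_functional \<mu> s \<Omega> u v =
     (let M = induced_measure \<mu>;
          f = (\<lambda>x y. (\<bar>u x - u y\<bar> - \<bar>v x - v y\<bar>) / enn2ereal (frac_weight \<mu> s x y))
      in ext_set_integral M \<Omega> (\<lambda>y. ext_set_integral M \<Omega> (\<lambda>x. f x y))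
         + 2 * ext_set_integral M \<Omega> (\<lambda>y. ext_set_integral M (- \<Omega>) (\<lambda>x. f x y)))"

definition superminimizer ::
    "('a::metric_space set \<Rightarrow> ennreal) \<Rightarrow> real \<Rightarrow> 'a set \<Rightarrow> ('a \<Rightarrow> ereal) \<Rightarrow> bool" where
  "superminimizer \<mu> s \<Omega> u \<longleftrightarrow>
     u \<in> borel_measurable (induced_measure \<mu>) \<and>
     u \<in> frac_hom_sobolev \<mu> s \<Omega> \<and>
     (\<forall>\<eta>\<in>frac_sobolev_zero \<mu> s \<Omega>. (\<forall>x. 0 \<le> \<eta> x) \<longrightarrow>
        frac_functional \<mu> s \<Omega> u (\<lambda>x. u x + \<eta> x) \<le> 0)"


section \<open>Approximate limits\<close>

definition lower_approx_limit ::
    "('a::metric_space set \<Rightarrow> ennreal) \<Rightarrow> ('a \<Rightarrow> ereal) \<Rightarrow> 'a \<Rightarrow> ereal" where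
  "lower_approx_limit \<mu> u x =
     Sup (ereal ` {t. ((\<lambda>r. \<mu> {y \<in> ball x r. u y < ereal t} / \<mu> (ball x r)) \<longlongrightarrow> 0) (at_right 0)})"

definition upper_approx_limit ::
    "('a::metric_space set \<Rightarrow> ennreal) \<Rightarrow> ('a \<Rightarrow> ereal) \<Rightarrow> 'a \<Rightarrow> ereal" where
  "upper_approx_limit \<mu> u x =
     Inf (ereal ` {t. ((\<lambda>r. \<mu> {y \<in> ball x r. u y > ereal t} / \<mu> (ball x r)) \<longlongrightarrow> 0) (at_right 0)})"


section \<open>Capacities and thinness\<close>

definition frac_capacity ::
    "('a::metric_space set \<Rightarrow> ennreal) \<Rightarrow> real \<Rightarrow> 'a set \<Rightarrow> ennreal" where
  "frac_capacity \<mu> s A =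
     (INF u \<in> {u \<in> frac_sobolev \<mu> s UNIV. \<exists>U. open U \<and> A \<subseteq> U \<and> (\<forall>y\<in>U. u y = 1)}.
        frac_norm \<mu> s UNIV u)"

text \<open>
  Meant for bounded \<open>A\<close>, bounded open \<open>F\<close> and compact \<open>closure A \<subseteq> F\<close>.  In \<open>frac_thin\<close> this
  holds automatically, because a complete space with a doubling measure is proper.
\<close>

definition condenser_capacity ::
    "('a::metric_space set \<Rightarrow> ennreal) \<Rightarrow> real \<Rightarrow> 'a set \<Rightarrow> 'a set \<Rightarrow> ennreal" where
  "condenser_capacity \<mu> s A F =
     (INF u \<in> {u \<in> frac_hom_sobolev \<mu> s UNIV.
                 (\<exists>U. open U \<and> A \<subseteq> U \<and> (\<forall>y\<in>U. u y = 1)) \<and> closure {y. u y \<noteq> 0} \<subseteq> F}.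
        frac_seminorm \<mu> s UNIV u)"

definition frac_thin ::
    "('a::metric_space set \<Rightarrow> ennreal) \<Rightarrow> real \<Rightarrow> 'a set \<Rightarrow> 'a \<Rightarrow> bool" where
  "frac_thin \<mu> s A x \<longleftrightarrow>
     ((\<lambda>r. condenser_capacity \<mu> s (A \<inter> ball x r) (ball x (2 * r))
          / condenser_capacity \<mu> s (ball x r) (ball x (2 * r))) \<longlongrightarrow> 0) (at_right 0)"

end

(*
  Write K(x,y) for the kernel 1/(mu(B_{x,y}) d(x,y)^s), phi(r) = mu(B(x,r))/r^s, and J for the
  seminorm with kernel K.  Testing the capacity of {x} with cutoff functions shows that phi is bounded
  below near x.  Comparing the averages of a function v >= 0 with J(v) < oo over successive dyadic annuli
  around x then gives a Hardy inequality: above a level L of order J(v) / inf phi, the superlevel sets of v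
  have finite integral of d(x,.)^(-s), so they have density 0 at x.

  At a radius where phi is almost minimal, thinness yields a function v that is 1 near A and whose energy is
  so small that L <= 1/4.  By the Hardy inequality, w = (2v-1)_+ multiplied by cutoffs at scale delta has
  energy tending to 0 as delta -> 0, by dominated convergence; summing a sparse sequence of such products
  gives psi of finite energy, supported in the ball, with psi -> oo along A.  The minimizer u >= psi of the
  energy is a superminimizer, and the Hardy inequality for u bounds its upper approximate limit at x.
*)
theory Submission
  imports Defs
begin

text \<open>Thinness makes the capacity of A near x small against that of the ball, and cutoffs
  bound the latter by a multiple of phi(r). The level L, however, is governed by the infimum of phi
  over all smaller scales, and at a general radius nothing compares phi(r) with that infimum. At an
  almost minimal radius the two are comparable, and the unknown size of phi cancels.

  Cutoffs alone cannot have energy tending to 0, because the point has positive capacity. The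
  product with w can, since w d(x,.)^(-s) is integrable. For v this integrability is known only on
  superlevel sets above L, so v is replaced by (2v-1)_+, which vanishes where v is at most 1/2 and
  is still 1 where v is 1.

  Connectedness enters through annuli: a point at an intermediate distance forces each annulus to
  carry a fixed fraction of the mass of the ball, which makes averages over neighbouring annuli
  comparable.

  The bound on R_0 leaves a set of positive measure outside the ball. Competitors vanish there, and
  this keeps the limit of a minimizing sequence finite almost everywhere.\<close>

section \<open>Dyadic scales, extended arithmetic and signed integrals\<close>

lemma ex_dyadic_below:
  fixes d R :: real
  assumes "0 < d" "d < R"
  shows "\<exists>k. R / 2 ^ Suc k \<le> d \<and> d < R / 2 ^ k"
proof -
  obtain n where n: "R / d < 2 ^ n"
    using real_arch_pow[of 2 "R / d"] by auto
  define P where "P n \<longleftrightarrow> R / 2 ^ n \<le> d" for n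
  have "P n"
    using n assms by (simp add: P_def field_simps)
  then have "P (Least P)" and least: "\<And>k. k < Least P \<Longrightarrow> \<not> P k"
    by (auto intro: LeastI dest: not_less_Least)
  moreover have "\<not> P 0"
    using assms by (simp add: P_def)
  ultimately obtain k where k: "Least P = Suc k"
    by (cases "Least P") auto
  show ?thesis
    using \<open>P (Least P)\<close> least[of k] k by (auto simp: P_def)
qed

lemma ex_dyadic_above:
  fixes d t :: real
  assumes "0 < t" "t \<le> d"
  shows "\<exists>n. t * 2 ^ n \<le> d \<and> d < t * 2 ^ Suc n"
proof -
  obtain n where n: "d / t < 2 ^ n"
    using real_arch_pow[of 2 "d / t"] by auto
  define P where "P n \<longleftrightarrow> d < t * 2 ^ n" for n
  have "P n"
    using n assms by (simp add: P_def field_simps)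
  then have "P (Least P)" and least: "\<And>k. k < Least P \<Longrightarrow> \<not> P k"
    by (auto intro: LeastI dest: not_less_Least)
  moreover have "\<not> P 0"
    using assms by (simp add: P_def)
  ultimately obtain k where k: "Least P = Suc k"
    by (cases "Least P") auto
  show ?thesis
    using \<open>P (Least P)\<close> least[of k] k by (intro exI[of _ k]) (auto simp: P_def)
qed

lemma ennreal_inverse_antimono:
  fixes a b :: ennreal
  assumes "a \<le> b"
  shows "inverse b \<le> inverse a"
  proof (cases a)
  case (real r)
  show ?thesis
  proof (cases b)
    case (real q)
    with assms \<open>a = ennreal r\<close> \<open>0 \<le> r\<close> show ?thesis
      by (cases "r = 0") (auto simp: inverse_ennreal intro!: ennreal_leI le_imp_inverse_le)
  qed auto
next
  case top
  with assms show ?thesis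
    by (simp add: top_unique)
qed

text \<open>A nonzero number divided by 0 is \<open>top\<close>, so for \<open>b = 0\<close> the
  strict bound forces \<open>a = 0\<close>. The lemma clears the denominator of the quotient in
  \<open>frac_thin\<close>.\<close>

lemma ennreal_divide_less_imp_le:
  fixes a b c :: ennreal
  assumes "a / b < c" "b < top"
  shows "a \<le> c * b"
proof (cases "b = 0")
  case True
  have "a = 0"
  proof (rule ccontr)
    assume "a \<noteq> 0"
    with True assms(1) show False
      by (simp add: divide_ennreal_def ennreal_mult_top)
  qed
  then show ?thesis
    by simp
next
  case False
  then have "a = a / b * b"
    using assms(2) by (simp add: ennreal_times_divide mult.commute mult_divide_eq_ennreal less_top)
  also have "\<dots> \<le> c * b"
    using assms(1) by (intro mult_right_mono) auto
  finally show ?thesis .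
qed

text \<open>Integrability makes the integrals of the positive and the negative part finite, so the
  convention for \<open>\<infinity> - \<infinity>\<close> in \<open>ext_set_integral\<close> is
  never met.\<close>

lemma ext_set_integral_eq:
  assumes [measurable]: "S \<in> sets M" and int: "integrable M (\<lambda>x. indicator S x * g x)"
    and eq: "AE x in M. x \<in> S \<longrightarrow> f x = ereal (g x)"
  shows "ext_set_integral M S f = ereal (\<integral>x. indicator S x * g x \<partial>M)"
proof -
  let ?h = "\<lambda>x. indicator S x * g x"
  have 1: "(\<integral>\<^sup>+x\<in>S. e2ennreal (f x) \<partial>M) = (\<integral>\<^sup>+x. ennreal (?h x) \<partial>M)"
    by (rule nn_integral_cong_AE, use eq in eventually_elim) (auto split: split_indicator simp: e2ennreal_ereal)
  have 2: "(\<integral>\<^sup>+x\<in>S. e2ennreal (- f x) \<partial>M) = (\<integral>\<^sup>+x. ennreal (- ?h x) \<partial>M)"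
    by (rule nn_integral_cong_AE, use eq in eventually_elim) (auto split: split_indicator simp: e2ennreal_ereal)
  have 3: "(\<integral>\<^sup>+x. ennreal (?h x) \<partial>M) < top" "(\<integral>\<^sup>+x. ennreal (- ?h x) \<partial>M) < top"
    using int unfolding real_integrable_def by (auto simp: less_top)
  then have "enn2ereal (\<integral>\<^sup>+x. ennreal (?h x) \<partial>M) = ereal (enn2real (\<integral>\<^sup>+x. ennreal (?h x) \<partial>M))"
    "enn2ereal (\<integral>\<^sup>+x. ennreal (- ?h x) \<partial>M) = ereal (enn2real (\<integral>\<^sup>+x. ennreal (- ?h x) \<partial>M))"
    by (metis enn2ereal_ennreal enn2real_nonneg ennreal_enn2real)+
  then show ?thesis
    unfolding ext_set_integral_def 1 2 using real_lebesgue_integral_def[OF int] by simp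
qed

section \<open>The fractional kernel of a doubling measure\<close>

text \<open>\<open>sets M\<close> may be larger than the Borel algebra, as the Caratheodory algebra
  is, so measurability is transferred along an inclusion. A doubling constant can always be
  enlarged, which gives \<open>1 \<le> C\<close> and settles the signs in later estimates.\<close>

locale doubling_space =
  fixes M :: "'a::polish_space measure" and C s :: real
  assumes space_M [simp]: "space M = UNIV"
    and sets_borel_subset: "sets borel \<subseteq> sets M"
    and C_ge_1: "1 \<le> C"
    and s_pos: "0 < s" and s_less_1: "s < 1"
    and emeasure_ball_pos: "0 < r \<Longrightarrow> 0 < emeasure M (ball x r)"
    and emeasure_ball_finite: "0 < r \<Longrightarrow> emeasure M (ball x r) < top"
    and emeasure_ball_double: "0 < r \<Longrightarrow> emeasure M (ball x (2 * r)) \<le> ennreal C * emeasure M (ball x r)"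
begin

lemma open_in_sets: "open S \<Longrightarrow> S \<in> sets M"
  using sets_borel_subset borel_open by blast

lemma closed_in_sets: "closed S \<Longrightarrow> S \<in> sets M"
  using sets_borel_subset borel_closed by blast

lemma ball_in_sets [measurable, simp]: "ball x r \<in> sets M"
  by (simp add: open_in_sets)

lemma borel_measurable_M: "f \<in> borel_measurable borel \<Longrightarrow> f \<in> borel_measurable M"
  using sets_borel_subset by (auto simp: measurable_def)

lemma ident_measurable [measurable]: "(\<lambda>x. x) \<in> M \<rightarrow>\<^sub>M borel"
  by (rule borel_measurable_M) simp

lemma sigma_finite_M: "sigma_finite_measure M"
proof
  define F where "F = range (\<lambda>n. ball (undefined::'a) (real (Suc n)))"
  have "countable F"
    by (simp add: F_def)
  moreover have "F \<subseteq> sets M"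
    by (auto simp: F_def)
  moreover have "\<Union>F = space M"
  proof -
    have "\<exists>n. dist undefined x < real (Suc n)" for x :: 'a
      by (meson less_SucI of_nat_less_iff order_less_trans reals_Archimedean2 lessI)
    then show ?thesis
      by (auto simp: F_def)
  qed
  moreover have "\<forall>a\<in>F. emeasure M a \<noteq> \<infinity>"
    using emeasure_ball_finite by (auto simp: F_def less_top[symmetric])
  ultimately show "\<exists>A. countable A \<and> A \<subseteq> sets M \<and> \<Union>A = space M \<and> (\<forall>a\<in>A. emeasure M a \<noteq> \<infinity>)"
    by blast
qed

sublocale sigma_finite_measure M
  by (rule sigma_finite_M)

sublocale pair_sigma_finite M M ..

lemma emeasure_ball_le_power:
  assumes "0 < r"
  shows "emeasure M (ball x (2 ^ n * r)) \<le> ennreal (C ^ n) * emeasure M (ball x r)"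
proof (induction n)
  case (Suc n)
  have "emeasure M (ball x (2 ^ Suc n * r)) \<le> ennreal C * emeasure M (ball x (2 ^ n * r))"
    using emeasure_ball_double[of "2 ^ n * r" x] assms by (simp add: mult.assoc)
  also have "\<dots> \<le> ennreal C * (ennreal (C ^ n) * emeasure M (ball x r))"
    by (intro mult_left_mono Suc) auto
  also have "\<dots> = ennreal (C ^ Suc n) * emeasure M (ball x r)"
    using C_ge_1 by (simp add: ennreal_mult mult.assoc)
  finally show ?case .
qed simp

text \<open>On the diagonal both balls are empty and the reciprocal of the weight is
  \<open>\<infinity>\<close>. The integrands below carry a factor that vanishes there, and
  \<open>\<infinity> * 0 = 0\<close>.\<close>

definition kern :: "'a \<times> 'a \<Rightarrow> ennreal" where
  "kern p = inverse (emeasure M (ball_pair (fst p) (snd p)) * ennreal (dist (fst p) (snd p) powr s))"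

lemma dist_measurable_pair [measurable]:
  "(\<lambda>p. dist (fst p) (snd p)) \<in> borel_measurable (M \<Otimes>\<^sub>M M)"
  by (intro borel_measurable_dist measurable_compose[OF measurable_fst ident_measurable]
      measurable_compose[OF measurable_snd ident_measurable])

text \<open>The mass of \<open>ball_pair x y\<close> is the mass of the section at
  \<open>(x, y)\<close> of a set in the triple product that is cut out by strict inequalities
  between distances, so it depends measurably on the pair.\<close>

lemma kern_measurable [measurable]: "kern \<in> borel_measurable (M \<Otimes>\<^sub>M M)"
proof -
  define Q where "Q = {q. snd q \<in> ball_pair (fst (fst q)) (snd (fst q :: 'a \<times> 'a))}"
  have f1 [measurable]: "(\<lambda>q. fst (fst q)) \<in> (M \<Otimes>\<^sub>M M) \<Otimes>\<^sub>M M \<rightarrow>\<^sub>M borel"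
    by (rule measurable_compose[OF _ ident_measurable]) simp
  have f2 [measurable]: "(\<lambda>q. snd (fst q)) \<in> (M \<Otimes>\<^sub>M M) \<Otimes>\<^sub>M M \<rightarrow>\<^sub>M borel"
    by (rule measurable_compose[OF _ ident_measurable]) simp
  have f3 [measurable]: "(\<lambda>q. snd q) \<in> (M \<Otimes>\<^sub>M M) \<Otimes>\<^sub>M M \<rightarrow>\<^sub>M borel"
    by (rule measurable_compose[OF _ ident_measurable]) simp
  have "Q = {q \<in> space ((M \<Otimes>\<^sub>M M) \<Otimes>\<^sub>M M).
      dist (fst (fst q)) (snd q) < dist (fst (fst q)) (snd (fst q)) \<or>
      dist (snd (fst q)) (snd q) < dist (fst (fst q)) (snd (fst q))}"
    by (auto simp: Q_def ball_pair_def space_pair_measure)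
  also have "\<dots> \<in> sets ((M \<Otimes>\<^sub>M M) \<Otimes>\<^sub>M M)"
    by measurable
  finally have "Q \<in> sets ((M \<Otimes>\<^sub>M M) \<Otimes>\<^sub>M M)" .
  then have "(\<lambda>p. emeasure M (Pair p -` Q)) \<in> borel_measurable (M \<Otimes>\<^sub>M M)"
    using sigma_finite_measure.measurable_emeasure_Pair[OF sigma_finite_M, where Q = Q and N = "M \<Otimes>\<^sub>M M"] by simp
  moreover have "Pair p -` Q = ball_pair (fst p) (snd p)" for p
    by (auto simp: Q_def)
  ultimately have [measurable]: "(\<lambda>p. emeasure M (ball_pair (fst p) (snd p))) \<in> borel_measurable (M \<Otimes>\<^sub>M M)"
    by simp
  show ?thesis
    unfolding kern_def by measurable
qed

lemma ball_pair_in_sets [simp]: "ball_pair x y \<in> sets M"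
  by (simp add: ball_pair_def)

lemma kern_commute: "kern (x, y) = kern (y, x)"
  by (simp add: kern_def ball_pair_def dist_commute Un_commute)

lemma ball_pair_subset: "ball_pair x y \<subseteq> ball x (2 * dist x y)"
proof
  fix z assume "z \<in> ball_pair x y"
  then show "z \<in> ball x (2 * dist x y)"
    using dist_triangle[of x z y] zero_le_dist[of x y] by (auto simp: ball_pair_def dist_commute simp del: zero_le_dist)
qed

lemma weight_bounds:
  assumes "x \<noteq> y"
  shows "emeasure M (ball_pair x y) * ennreal (dist x y powr s) \<noteq> 0"
    and "emeasure M (ball_pair x y) * ennreal (dist x y powr s) \<noteq> \<infinity>"
proof -
  have "0 < emeasure M (ball x (dist x y))"
    using assms by (simp add: emeasure_ball_pos)
  also have "\<dots> \<le> emeasure M (ball_pair x y)"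
    by (intro emeasure_mono) (auto simp: ball_pair_def)
  finally show "emeasure M (ball_pair x y) * ennreal (dist x y powr s) \<noteq> 0"
    using assms by auto
  have "emeasure M (ball_pair x y) \<le> emeasure M (ball x (2 * dist x y))"
    by (intro emeasure_mono ball_pair_subset) auto
  also have "\<dots> < top"
    using assms by (simp add: emeasure_ball_finite)
  finally show "emeasure M (ball_pair x y) * ennreal (dist x y powr s) \<noteq> \<infinity>"
    by (auto simp: ennreal_mult_eq_top_iff)
qed

text \<open>On the annulus \<open>ball y \<rho>\<close> lies in \<open>ball_pair x y\<close>, which
  bounds the kernel by a constant. The annulus is closed and is therefore put into the ball of
  radius \<open>4 * \<rho>\<close>: two doublings give \<open>C ^ 2\<close>, and the mass of
  \<open>ball y \<rho>\<close> cancels.\<close>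

lemma kern_annulus:
  assumes "0 < \<rho>"
  shows "(\<integral>\<^sup>+x. kern (x, y) * indicator {x. \<rho> \<le> dist x y \<and> dist x y \<le> 2 * \<rho>} x \<partial>M)
           \<le> ennreal (C ^ 2 * \<rho> powr - s)"
proof -
  define S where "S = {x. \<rho> \<le> dist x y \<and> dist x y \<le> 2 * \<rho>}"
  have [measurable]: "S \<in> sets M"
  proof -
    have "closed S"
      unfolding S_def by (intro closed_Collect_conj closed_Collect_le continuous_intros)
    then show ?thesis
      by (rule closed_in_sets)
  qed
  let ?b = "emeasure M (ball y \<rho>)"
  have b: "?b \<noteq> 0" "?b \<noteq> \<infinity>"
    using emeasure_ball_pos[OF assms, of y] emeasure_ball_finite[OF assms, of y] by auto
  have w: "inverse (?b * ennreal (\<rho> powr s)) = inverse ?b * ennreal (\<rho> powr - s)"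
    using assms b by (simp add: ennreal_inverse_mult powr_minus inverse_ennreal less_top)
  have "(\<integral>\<^sup>+x. kern (x, y) * indicator S x \<partial>M) \<le> (\<integral>\<^sup>+x. inverse (?b * ennreal (\<rho> powr s)) * indicator S x \<partial>M)"
  proof (intro nn_integral_mono)
    fix x
    show "kern (x, y) * indicator S x \<le> inverse (?b * ennreal (\<rho> powr s)) * indicator S x"
    proof (cases "x \<in> S")
      case True
      then have "ball y \<rho> \<subseteq> ball_pair x y"
        by (auto simp: S_def ball_pair_def)
      then have "?b * ennreal (\<rho> powr s) \<le> emeasure M (ball_pair x y) * ennreal (dist x y powr s)"
        using True assms s_pos
        by (intro mult_mono emeasure_mono ennreal_leI powr_mono2) (auto simp: S_def)
      then show ?thesis
        using True by (simp add: kern_def ennreal_inverse_antimono)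
    qed simp
  qed
  also have "\<dots> = inverse (?b * ennreal (\<rho> powr s)) * emeasure M S"
    by (simp add: nn_integral_cmult)
  also have "\<dots> \<le> inverse (?b * ennreal (\<rho> powr s)) * (ennreal (C ^ 2) * ?b)"
  proof (intro mult_left_mono)
    have "S \<subseteq> ball y (2 ^ 2 * \<rho>)"
      using assms by (auto simp: S_def dist_commute)
    then have "emeasure M S \<le> emeasure M (ball y (2 ^ 2 * \<rho>))"
      by (intro emeasure_mono) auto
    also have "\<dots> \<le> ennreal (C ^ 2) * ?b"
      by (rule emeasure_ball_le_power[OF assms])
    finally show "emeasure M S \<le> ennreal (C ^ 2) * ?b" .
  qed simp
  also have "\<dots> = ennreal (C ^ 2) * ennreal (\<rho> powr - s) * (inverse ?b * ?b)"
    unfolding w by (simp add: ac_simps)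
  also have "inverse ?b * ?b = 1"
    using b ennreal_divide_self[of ?b] by (simp add: divide_ennreal_def mult.commute less_top)
  finally show ?thesis
    by (simp add: S_def ennreal_mult)
qed

text \<open>The two fractions are geometric series over dyadic annuli: ratio
  \<open>2 powr - s\<close> outside radius \<open>t\<close>, where the mass of the kernel decays,
  and \<open>2 powr (s - 1)\<close> inside, where the factor \<open>dist x y / t\<close> beats its
  growth. They converge because \<open>0 < s < 1\<close>.\<close>

definition kern_const :: real where
  "kern_const = C ^ 2 * (1 / (1 - 2 powr - s) + 2 powr s / (1 - 2 powr (s - 1)))"

lemma kern_const_pos: "0 < kern_const"
proof -
  have "2 powr - s < 1" "2 powr (s - 1) < 1"
    using s_pos s_less_1 by (auto simp: powr_less_one)
  then show ?thesis
    using C_ge_1 by (auto simp: kern_const_def intro!: mult_pos_pos add_pos_pos)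
qed

text \<open>The factor \<open>min 1 (dist x y / t)\<close> bounds the increment of a function with
  values in [0,1] that is Lipschitz on scale \<open>t\<close>, so this is the estimate behind all
  cutoffs. Annuli beyond radius \<open>t\<close> use the bound 1; the n-th annulus inside uses
  \<open>(1/2) ^ n\<close>.\<close>

lemma kern_bound:
  assumes t: "0 < t"
  shows "(\<integral>\<^sup>+x. ennreal (min 1 (dist x y / t)) * kern (x, y) \<partial>M) \<le> ennreal (kern_const * t powr - s)"
proof -
  \<comment> \<open>Neighbouring closed annuli share a sphere, which does no harm to an upper bound
    by the sum over all of them.\<close>
  define Ou where "Ou n = {x. t * 2 ^ n \<le> dist x y \<and> dist x y \<le> 2 * (t * 2 ^ n)}" for n :: nat
  define In where "In n = {x. t / 2 ^ Suc n \<le> dist x y \<and> dist x y \<le> 2 * (t / 2 ^ Suc n)}" for n :: nat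
  define f where "f x = kern (x, y)" for x
  have [measurable]: "f \<in> borel_measurable M"
    unfolding f_def by measurable
  have [measurable]: "Ou n \<in> sets M" "In n \<in> sets M" for n
    unfolding Ou_def In_def
    by (intro closed_in_sets closed_Collect_conj closed_Collect_le continuous_intros)+
  have le: "ennreal (min 1 (dist x y / t)) * f x \<le>
      (\<Sum>n. f x * indicator (Ou n) x) + (\<Sum>n. ennreal ((1/2) ^ n) * (f x * indicator (In n) x))" for x
  proof -
    consider "x = y" | "t \<le> dist x y" | "0 < dist x y" "dist x y < t"
      by fastforce
    then show ?thesis
    proof cases
      case 2
      then obtain n where n: "t * 2 ^ n \<le> dist x y \<and> dist x y < t * 2 ^ Suc n"
        using ex_dyadic_above[OF t] by blast
      have "ennreal (min 1 (dist x y / t)) * f x \<le> 1 * f x"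
        by (intro mult_right_mono) (auto simp: ennreal_le_1)
      also have "\<dots> = f x * indicator (Ou n) x"
        using n by (simp add: Ou_def)
      also have "\<dots> = sum (\<lambda>n. f x * indicator (Ou n) x) {n}"
        by (simp del: sum_mult_indicator)
      also have "\<dots> \<le> (\<Sum>n. f x * indicator (Ou n) x)"
        by (rule sum_le_suminf) auto
      finally show ?thesis
        by (simp add: add_increasing2)
    next
      case 3
      then obtain n where n: "t / 2 ^ Suc n \<le> dist x y \<and> dist x y < t / 2 ^ n"
        using ex_dyadic_below by blast
      have "dist x y / t \<le> (1 / 2) ^ n"
        using n t by (simp add: field_simps power_one_over)
      then have "ennreal (min 1 (dist x y / t)) * f x \<le> ennreal ((1 / 2) ^ n) * f x"
        by (intro mult_right_mono ennreal_leI) auto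
      also have "\<dots> = ennreal ((1 / 2) ^ n) * (f x * indicator (In n) x)"
        using n by (simp add: In_def)
      also have "\<dots> = sum (\<lambda>n. ennreal ((1 / 2) ^ n) * (f x * indicator (In n) x)) {n}"
        by (simp del: sum_mult_indicator)
      also have "\<dots> \<le> (\<Sum>n. ennreal ((1 / 2) ^ n) * (f x * indicator (In n) x))"
        by (rule sum_le_suminf) auto
      finally show ?thesis
        by (simp add: add_increasing)
    qed simp
  qed
  have "(\<integral>\<^sup>+x. ennreal (min 1 (dist x y / t)) * f x \<partial>M) \<le>
      (\<integral>\<^sup>+x. (\<Sum>n. f x * indicator (Ou n) x) + (\<Sum>n. ennreal ((1/2) ^ n) * (f x * indicator (In n) x)) \<partial>M)"
    by (intro nn_integral_mono le)
  also have "\<dots> = (\<Sum>n. \<integral>\<^sup>+x. f x * indicator (Ou n) x \<partial>M) +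
      (\<Sum>n. ennreal ((1/2) ^ n) * (\<integral>\<^sup>+x. f x * indicator (In n) x \<partial>M))"
    by (subst nn_integral_add) (auto simp: nn_integral_suminf nn_integral_cmult simp del: ennreal_suminf_cmult)
  also have "\<dots> \<le> (\<Sum>n. ennreal (C ^ 2 * t powr - s * (2 powr - s) ^ n)) +
      (\<Sum>n. ennreal (C ^ 2 * t powr - s * 2 powr s * (2 powr (s - 1)) ^ n))"
  proof (intro add_mono suminf_le summableI)
    fix n
    have "(\<integral>\<^sup>+x. f x * indicator (Ou n) x \<partial>M) \<le> ennreal (C ^ 2 * (t * 2 ^ n) powr - s)"
      unfolding f_def Ou_def using t by (intro kern_annulus) auto
    also have "(t * 2 ^ n) powr - s = t powr - s * (2 powr - s) ^ n"
      using t by (simp add: powr_mult powr_powr mult.commute flip: powr_realpow)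
    finally show "(\<integral>\<^sup>+x. f x * indicator (Ou n) x \<partial>M) \<le> ennreal (C ^ 2 * t powr - s * (2 powr - s) ^ n)"
      by (simp add: mult.assoc)
    have "ennreal ((1/2) ^ n) * (\<integral>\<^sup>+x. f x * indicator (In n) x \<partial>M)
        \<le> ennreal ((1/2) ^ n) * ennreal (C ^ 2 * (t / 2 ^ Suc n) powr - s)"
      unfolding f_def In_def using t by (intro mult_left_mono kern_annulus) auto
    also have "\<dots> = ennreal (C ^ 2 * ((1/2) ^ n * (t / 2 ^ Suc n) powr - s))"
      by (simp add: ac_simps flip: ennreal_mult)
    also have "(1/2) ^ n * (t / 2 ^ Suc n) powr - s = t powr - s * 2 powr s * (2 powr (s - 1)) ^ n"
    proof -
      have "(t / 2 ^ Suc n) powr - s = t powr - s * 2 powr (s * (1 + real n))"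
        using t by (simp add: powr_divide powr_minus powr_powr mult.commute field_simps flip: powr_realpow power_Suc)
      moreover have "(1/2) ^ n = 2 powr - real n"
        by (simp add: powr_minus powr_realpow power_one_over inverse_eq_divide)
      moreover have "2 powr - real n * 2 powr (s * (1 + real n)) = 2 powr s * (2 powr (s - 1)) ^ n"
        by (simp add: powr_powr flip: powr_realpow powr_add) (simp add: algebra_simps)
      ultimately show ?thesis
        by (simp add: mult.commute mult.left_commute)
    qed
    finally show "ennreal ((1/2) ^ n) * (\<integral>\<^sup>+x. f x * indicator (In n) x \<partial>M)
        \<le> ennreal (C ^ 2 * t powr - s * 2 powr s * (2 powr (s - 1)) ^ n)"
      by (simp add: mult.assoc)
  qed
  also have "\<dots> = ennreal (C ^ 2 * t powr - s * (1 / (1 - 2 powr - s))) +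
      ennreal (C ^ 2 * t powr - s * 2 powr s * (1 / (1 - 2 powr (s - 1))))"
  proof -
    have geo: "(\<Sum>n. ennreal (a * q ^ n)) = ennreal (a * (1 / (1 - q)))" if "0 \<le> a" "0 \<le> q" "q < 1" for a q :: real
    proof -
      have "(\<lambda>n. a * q ^ n) sums (a * (1 / (1 - q)))"
        using that by (intro sums_mult geometric_sums) auto
      then show ?thesis
        using that by (subst suminf_ennreal_eq) auto
    qed
    have "2 powr - s < 1" "2 powr (s - 1) < 1"
      using s_pos s_less_1 by (auto simp: powr_less_one)
    then show ?thesis
      by (intro arg_cong2[where f = "(+)"] geo) auto
  qed
  also have "\<dots> = ennreal (kern_const * t powr - s)"
  proof -
    have "2 powr - s < 1" "2 powr (s - 1) < 1"
      using s_pos s_less_1 by (auto simp: powr_less_one)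
    then show ?thesis
      by (subst ennreal_plus[symmetric]) (auto simp: kern_const_def algebra_simps)
  qed
  finally show ?thesis
    by (simp add: f_def)
qed

text \<open>The distances to \<open>x0\<close> form an interval, so some \<open>y\<close> lies in
  the middle of the annulus, at distance \<open>3 / 2 * \<rho>\<close>. The annulus contains
  \<open>ball y (\<rho> / 2)\<close>, and the ball around \<open>y\<close> of eight times that
  radius covers \<open>ball x0 (2 * \<rho>)\<close>.\<close>

lemma annulus_mass:
  assumes conn: "connected (UNIV :: 'a set)" and \<rho>: "0 < \<rho>" and far: "3 / 2 * \<rho> \<le> dist x0 z"
  shows "emeasure M (ball x0 (2 * \<rho>)) \<le> ennreal (C ^ 3) * emeasure M (ball x0 (2 * \<rho>) - ball x0 \<rho>)"
proof -
  have "connected (dist x0 ` UNIV)"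
    by (intro connected_continuous_image conn continuous_intros)
  moreover have "dist x0 x0 \<in> dist x0 ` UNIV" "dist x0 z \<in> dist x0 ` UNIV"
    by blast+
  ultimately have "3 / 2 * \<rho> \<in> dist x0 ` UNIV"
    using \<rho> far unfolding connected_iff_interval by (metis dist_self less_eq_real_def mult_pos_pos zero_less_divide_iff zero_less_numeral)
  then obtain y where y: "dist x0 y = 3 / 2 * \<rho>"
    by auto
  have "ball x0 (2 * \<rho>) \<subseteq> ball y (2 ^ 3 * (\<rho> / 2))"
  proof
    fix w assume "w \<in> ball x0 (2 * \<rho>)"
    then show "w \<in> ball y (2 ^ 3 * (\<rho> / 2))"
      using y dist_triangle[of y w x0] \<rho> by (simp add: dist_commute)
  qed
  then have "emeasure M (ball x0 (2 * \<rho>)) \<le> emeasure M (ball y (2 ^ 3 * (\<rho> / 2)))"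
    by (intro emeasure_mono) auto
  also have "\<dots> \<le> ennreal (C ^ 3) * emeasure M (ball y (\<rho> / 2))"
    using \<rho> by (intro emeasure_ball_le_power) auto
  also have "\<dots> \<le> ennreal (C ^ 3) * emeasure M (ball x0 (2 * \<rho>) - ball x0 \<rho>)"
  proof (intro mult_left_mono emeasure_mono subsetI)
    fix w assume "w \<in> ball y (\<rho> / 2)"
    then show "w \<in> ball x0 (2 * \<rho>) - ball x0 \<rho>"
      using y dist_triangle[of x0 w y] dist_triangle[of x0 y w] \<rho> by (simp add: dist_commute)
  qed auto
  finally show ?thesis .
qed

section \<open>Minimizing the energy above an obstacle\<close>

lemma AE_pair_both:
  assumes "AE y in M. P y"
  shows "AE p in M \<Otimes>\<^sub>M M. P (fst p) \<and> P (snd p)"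
proof -
  obtain N where N: "N \<in> null_sets M" "{y. \<not> P y} \<subseteq> N"
    using assms by (auto simp: eventually_ae_filter)
  then have [measurable]: "N \<in> sets M" and "emeasure M N = 0"
    by auto
  have UNIV: "UNIV \<in> sets M"
    using sets.top[of M] by simp
  have "N \<times> UNIV \<in> null_sets (M \<Otimes>\<^sub>M M)" "UNIV \<times> N \<in> null_sets (M \<Otimes>\<^sub>M M)"
    using sigma_finite_measure.emeasure_pair_measure_Times[OF sigma_finite_M \<open>N \<in> sets M\<close> UNIV]
      sigma_finite_measure.emeasure_pair_measure_Times[OF sigma_finite_M UNIV \<open>N \<in> sets M\<close>]
      \<open>emeasure M N = 0\<close> UNIV by (auto simp: null_sets_def)
  then have "N \<times> UNIV \<union> UNIV \<times> N \<in> null_sets (M \<Otimes>\<^sub>M M)"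
    by blast
  then show ?thesis
    by (rule AE_I') (use N(2) in auto)
qed

text \<open>The weight is a parameter since three of them occur: \<open>kern\<close>,
  \<open>kern\<close> with the second point restricted to a ball, and the weight belonging to the
  superminimizer functional. Real-valued functions keep infinite differences out of the
  estimates.\<close>

definition energy :: "('a \<times> 'a \<Rightarrow> ennreal) \<Rightarrow> ('a \<Rightarrow> real) \<Rightarrow> ennreal" where
  "energy W v = (\<integral>\<^sup>+p. W p * ennreal \<bar>v (fst p) - v (snd p)\<bar> \<partial>(M \<Otimes>\<^sub>M M))"

lemma energy_cong_AE:
  assumes "AE y in M. v y = w y"
  shows "energy W v = energy W w"
  unfolding energy_def using AE_pair_both[OF assms] by (intro nn_integral_cong_AE) auto

text \<open>Fatou's lemma on the product space. Finiteness of the weight off the diagonal lets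
  pointwise limits pass through the multiplication; on the diagonal every integrand is 0.\<close>

lemma energy_le_of_tendsto:
  assumes [measurable]: "W \<in> borel_measurable (M \<Otimes>\<^sub>M M)" "\<And>n. v n \<in> borel_measurable M"
    and W: "\<And>p. fst p \<noteq> snd p \<Longrightarrow> W p < top"
    and lim: "AE y in M. (\<lambda>n. v n y) \<longlonglongrightarrow> u y"
    and le: "\<And>n. energy W (v n) \<le> c"
  shows "energy W u \<le> c"
proof -
  have "energy W u = (\<integral>\<^sup>+p. liminf (\<lambda>n. W p * ennreal \<bar>v n (fst p) - v n (snd p)\<bar>) \<partial>(M \<Otimes>\<^sub>M M))"
    unfolding energy_def
  proof (rule nn_integral_cong_AE, use AE_pair_both[OF lim] in eventually_elim)
    case (elim p)
    have "(\<lambda>n. W p * ennreal \<bar>v n (fst p) - v n (snd p)\<bar>) \<longlonglongrightarrow> W p * ennreal \<bar>u (fst p) - u (snd p)\<bar>"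
    proof (cases "fst p = snd p")
      case False
      then show ?thesis
        using elim by (intro ennreal_tendsto_cmult W tendsto_ennrealI tendsto_intros) auto
    qed simp
    then show ?case
      by (intro lim_imp_Liminf[symmetric]) auto
  qed
  also have "\<dots> \<le> liminf (\<lambda>n. energy W (v n))"
    unfolding energy_def by (rule nn_integral_liminf) measurable
  also have "\<dots> \<le> c"
    using le by (simp add: Liminf_le always_eventually)
  finally show ?thesis .
qed

text \<open>Submodularity, which holds already pair by pair for absolute differences.\<close>

lemma energy_min_max:
  assumes [measurable]: "W \<in> borel_measurable (M \<Otimes>\<^sub>M M)" "f \<in> borel_measurable M" "g \<in> borel_measurable M"
  shows "energy W (\<lambda>y. min (f y) (g y)) + energy W (\<lambda>y. max (f y) (g y)) \<le> energy W f + energy W g"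
proof -
  have "\<bar>min a b - min c d\<bar> + \<bar>max a b - max c d\<bar> \<le> \<bar>a - c\<bar> + \<bar>b - d\<bar>" for a b c d :: real
    by (auto simp: min_def max_def)
  then have *: "W p * ennreal \<bar>min a b - min c d\<bar> + W p * ennreal \<bar>max a b - max c d\<bar>
      \<le> W p * ennreal \<bar>a - c\<bar> + W p * ennreal \<bar>b - d\<bar>" for a b c d p
    unfolding distrib_left[symmetric]
    by (intro mult_left_mono) (simp_all flip: ennreal_plus add: ennreal_leI del: min_less_iff_conj)
  show ?thesis
    unfolding energy_def by (subst (1 2) nn_integral_add[symmetric]) (auto intro!: nn_integral_mono *)
qed

text \<open>
  No compactness is needed: by \<open>energy_min_max\<close> the tail infima of a fast minimizing sequence still
  have almost minimal energy, and they increase to a minimizer.  The hypothesis \<open>pos\<close> makes the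
  limit finite almost everywhere.
\<close>

lemma energy_minimizer:
  assumes W [measurable]: "W \<in> borel_measurable (M \<Otimes>\<^sub>M M)" and Wfin: "\<And>p. fst p \<noteq> snd p \<Longrightarrow> W p < top"
    and [measurable]: "\<Omega> \<in> sets M" "\<psi> \<in> borel_measurable M"
    and \<psi>0: "\<And>y. 0 \<le> \<psi> y" and \<psi>\<Omega>: "\<And>y. y \<notin> \<Omega> \<Longrightarrow> \<psi> y = 0" and \<psi>fin: "energy W \<psi> < top"
    and pos: "\<And>y. y \<in> \<Omega> \<Longrightarrow> 0 < (\<integral>\<^sup>+x. indicator (- \<Omega>) x * W (x, y) \<partial>M)"
  obtains u where "u \<in> borel_measurable M" "\<And>y. \<psi> y \<le> u y" "\<And>y. y \<notin> \<Omega> \<Longrightarrow> u y = 0" "energy W u < top"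
    "\<And>v. v \<in> borel_measurable M \<Longrightarrow> (\<And>y. \<psi> y \<le> v y) \<Longrightarrow> (\<And>y. y \<notin> \<Omega> \<Longrightarrow> v y = 0)
      \<Longrightarrow> energy W u \<le> energy W v"
proof -
  define adm where "adm v \<longleftrightarrow> v \<in> borel_measurable M \<and> (\<forall>y. \<psi> y \<le> v y) \<and> (\<forall>y. y \<notin> \<Omega> \<longrightarrow> v y = 0)" for v
  define m where "m = (INF v\<in>Collect adm. energy W v)"
  have adm\<psi>: "adm \<psi>"
    using \<psi>\<Omega> by (simp add: adm_def)
  have m_le: "m \<le> energy W v" if "adm v" for v
    unfolding m_def using that by (auto intro: INF_lower)
  have m_fin: "m < top"
    using m_le[OF adm\<psi>] \<psi>fin by (rule le_less_trans)
  have "\<exists>v. adm v \<and> energy W v \<le> m + ennreal ((1/2) ^ i)" for i :: nat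
  proof -
    have "m < m + ennreal ((1/2) ^ i)"
      using m_fin by (auto simp: ennreal_add_left_cancel_less[of m 0, simplified])
    then show ?thesis
      unfolding m_def INF_less_iff by (auto intro: less_imp_le)
  qed
  then obtain f where f: "\<And>i. adm (f i)" "\<And>i. energy W (f i) \<le> m + ennreal ((1/2) ^ i)"
    by metis
  \<comment> \<open>\<open>g n N\<close> is the minimum of \<open>f n\<close>, ...,
    \<open>f (n + N)\<close>; as \<open>N\<close> grows it decreases to the tail infimum
    \<open>h n\<close>.\<close>
  define g where "g n = rec_nat (f n) (\<lambda>N h y. min (h y) (f (n + Suc N) y))" for n
  have g0: "g n 0 = f n" and gS: "g n (Suc N) = (\<lambda>y. min (g n N y) (f (n + Suc N) y))" for n N
    by (simp_all add: g_def)
  have g_adm: "adm (g n N)" for n N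
  proof (induction N)
    case (Suc N)
    have "adm (f (n + Suc N))"
      by (rule f)
    with Suc show ?case
      by (auto simp: adm_def gS)
  qed (simp add: g0 f)
  \<comment> \<open>Taking one more function into the minimum costs at most its excess over
    \<open>m\<close>, because the corresponding maximum is admissible and so has energy at least
    \<open>m\<close>. The excesses \<open>(1/2) ^ n + ... + (1/2) ^ (n + N)\<close> add up to the
    stated bound.\<close>
  have g_energy: "energy W (g n N) \<le> m + ennreal (2 * (1/2) ^ n - (1/2) ^ (n + N))" for n N
  proof (induction N)
    case 0
    then show ?case
      using f(2)[of n] by (simp add: g0)
  next
    case (Suc N)
    have a: "adm (\<lambda>y. max (g n N y) (f (n + Suc N) y))"
      using g_adm[of n N] f(1)[of "n + Suc N"] by (auto simp: adm_def intro: max.coboundedI1)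
    have le: "(1/2::real) ^ (n + N) \<le> 2 * (1/2) ^ n"
      using power_decreasing[of n "n + N" "1/2 :: real"] by (simp add: order_trans[OF _ mult_right_mono[of 1 2]])
    have "m + energy W (g n (Suc N)) \<le> energy W (g n (Suc N)) + energy W (\<lambda>y. max (g n N y) (f (n + Suc N) y))"
      using m_le[OF a] by (simp add: add.commute add_mono)
    also have "\<dots> \<le> energy W (g n N) + energy W (f (n + Suc N))"
      unfolding gS using g_adm[of n N] f(1)[of "n + Suc N"] by (intro energy_min_max) (auto simp: adm_def)
    also have "\<dots> \<le> (m + ennreal (2 * (1/2) ^ n - (1/2) ^ (n + N))) + (m + ennreal ((1/2) ^ (n + Suc N)))"
      by (intro add_mono Suc f)
    also have "\<dots> = m + (m + (ennreal (2 * (1/2) ^ n - (1/2) ^ (n + N)) + ennreal ((1/2) ^ (n + Suc N))))"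
      by (simp add: ac_simps)
    also have "ennreal (2 * (1/2) ^ n - (1/2) ^ (n + N)) + ennreal ((1/2) ^ (n + Suc N))
        = ennreal (2 * (1/2) ^ n - (1/2) ^ (n + Suc N))"
      using le by (subst ennreal_plus[symmetric]) auto
    finally show ?case
      using m_fin by (auto simp: ennreal_add_left_cancel_le)
  qed
  have g_meas [measurable]: "g n N \<in> borel_measurable M" for n N
    using g_adm by (simp add: adm_def)
  have g_nonneg: "0 \<le> g n N y" for n N y
    using g_adm[of n N] \<psi>0[of y] by (auto simp: adm_def intro: order_trans)
  define h where "h n y = lim (\<lambda>N. g n N y)" for n y
  have g_lim: "(\<lambda>N. g n N y) \<longlonglongrightarrow> h n y" for n y
  proof -
    have "decseq (\<lambda>N. g n N y)"
      by (auto simp: decseq_Suc_iff gS)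
    then have "convergent (\<lambda>N. g n N y)"
      using decseq_convergent[of "\<lambda>N. g n N y" 0] g_nonneg by (metis convergentI)
    then show ?thesis
      by (simp add: h_def convergent_LIMSEQ_iff)
  qed
  have h_meas [measurable]: "h n \<in> borel_measurable M" for n
    using borel_measurable_LIMSEQ_real[OF g_lim g_meas] by simp
  have h_\<psi>: "\<psi> y \<le> h n y" for n y
    using g_adm[of n] by (intro LIMSEQ_le_const[OF g_lim]) (auto simp: adm_def)
  have h_0: "h n y = 0" if "y \<notin> \<Omega>" for n y
    using g_lim[of n y] g_adm[of n] that by (simp add: adm_def LIMSEQ_const_iff)
  have h_nonneg: "0 \<le> h n y" for n y
    using h_\<psi>[of y n] \<psi>0[of y] by simp
  have h_Suc: "h n y \<le> h (Suc n) y" for n y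
  proof -
    have "g n (Suc N) y \<le> g (Suc n) N y" for N
    proof (induction N)
      case (Suc N)
      then show ?case
        unfolding gS[of n "Suc N"] gS[of "Suc n" N] by (auto simp: min_le_iff_disj)
    qed (simp add: g0 gS)
    then show ?thesis
      by (intro LIMSEQ_le[OF LIMSEQ_Suc[OF g_lim] g_lim]) auto
  qed
  have h_energy: "energy W (h n) \<le> m + ennreal (2 * (1/2) ^ n)" for n
  proof (rule energy_le_of_tendsto[OF W g_meas Wfin])
    show "AE y in M. (\<lambda>N. g n N y) \<longlonglongrightarrow> h n y"
      using g_lim by simp
    show "energy W (g n N) \<le> m + ennreal (2 * (1/2) ^ n)" for N
      by (rule order_trans[OF g_energy]) (auto intro!: add_left_mono ennreal_leI)
  qed
  define S where "S y = (SUP n. ennreal (h n y))" for y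
  have [measurable]: "S \<in> borel_measurable M"
    unfolding S_def by measurable
  have S_lim: "(\<lambda>n. ennreal (h n y)) \<longlonglongrightarrow> S y" for y
    unfolding S_def by (intro LIMSEQ_SUP) (auto simp: incseq_Suc_iff h_Suc intro: ennreal_leI)
  \<comment> \<open>\<open>k\<close> is the weight connecting a point of \<open>\<Omega>\<close>
    with the complement, where \<open>h n\<close> vanishes. The integral of \<open>k * h n\<close>
    is thus part of the energy and bounded in \<open>n\<close>. Since \<open>k\<close> is positive
    on \<open>\<Omega>\<close>, the monotone limit \<open>S\<close> is finite almost
    everywhere.\<close>
  define k where "k y = indicator \<Omega> y * (\<integral>\<^sup>+x. indicator (- \<Omega>) x * W (x, y) \<partial>M)" for y
  have [measurable]: "k \<in> borel_measurable M"
    unfolding k_def by measurable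
  have kh: "(\<integral>\<^sup>+y. k y * ennreal (h n y) \<partial>M) \<le> m + ennreal 2" for n
  proof -
    have "(\<integral>\<^sup>+y. k y * ennreal (h n y) \<partial>M) =
        (\<integral>\<^sup>+y. \<integral>\<^sup>+x. indicator \<Omega> y * ennreal (h n y) * (indicator (- \<Omega>) x * W (x, y)) \<partial>M \<partial>M)"
      by (intro nn_integral_cong) (simp add: k_def nn_integral_cmult ac_simps)
    also have "\<dots> \<le> (\<integral>\<^sup>+y. \<integral>\<^sup>+x. W (x, y) * ennreal \<bar>h n x - h n y\<bar> \<partial>M \<partial>M)"
      using h_0 h_nonneg by (intro nn_integral_mono) (auto split: split_indicator simp: mult.commute)
    also have "\<dots> = energy W (h n)"
      unfolding energy_def by (subst nn_integral_snd[symmetric]) auto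
    also have "\<dots> \<le> m + ennreal 2"
      by (intro order_trans[OF h_energy] add_left_mono ennreal_leI) (simp add: power_le_one)
    finally show ?thesis .
  qed
  have "(\<integral>\<^sup>+y. k y * S y \<partial>M) = (SUP n. \<integral>\<^sup>+y. k y * ennreal (h n y) \<partial>M)"
    unfolding S_def SUP_mult_left_ennreal
    by (intro nn_integral_monotone_convergence_SUP)
      (auto simp: incseq_Suc_iff le_fun_def h_Suc intro!: mult_left_mono ennreal_leI)
  also have "\<dots> \<le> m + ennreal 2"
    using kh by (rule SUP_least)
  also have "\<dots> < top"
    using m_fin by simp
  finally have "AE y in M. k y * S y \<noteq> \<infinity>"
    by (intro nn_integral_PInf_AE) auto
  then have S_fin: "AE y in M. S y < top"
  proof eventually_elim
    case (elim y)
    show ?case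
    proof (cases "y \<in> \<Omega>")
      case True
      then show ?thesis
        using elim pos[of y] by (auto simp: k_def ennreal_mult_eq_top_iff less_top)
    qed (simp add: S_def h_0)
  qed
  \<comment> \<open>Where \<open>S\<close> is infinite, on a null set, \<open>enn2real\<close>
    returns 0; the maximum keeps the obstacle condition true at every point.\<close>
  define u where "u y = max (\<psi> y) (enn2real (S y))" for y
  have hu: "(\<lambda>n. h n y) \<longlonglongrightarrow> u y" if fin: "S y < top" for y
  proof -
    obtain r where r: "0 \<le> r" "S y = ennreal r"
      using fin by (cases "S y") auto
    then have lim: "(\<lambda>n. h n y) \<longlonglongrightarrow> r"
      using S_lim[of y] h_nonneg by (simp add: tendsto_ennreal_iff)
    then have "\<psi> y \<le> r"
      by (rule LIMSEQ_le_const) (use h_\<psi> in auto)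
    with r lim show ?thesis
      by (simp add: u_def)
  qed
  have u_energy: "energy W u \<le> m"
  proof (rule ennreal_le_epsilon)
    fix e :: real assume "0 < e"
    then obtain n where n: "(1/2) ^ n < e / 2"
      using real_arch_pow_inv[of "e / 2" "1/2"] by auto
    show "energy W u \<le> m + ennreal e"
    proof (rule energy_le_of_tendsto[OF W _ Wfin])
      show "AE y in M. (\<lambda>i. h (i + n) y) \<longlonglongrightarrow> u y"
        using S_fin by eventually_elim (intro LIMSEQ_ignore_initial_segment hu)
      fix i
      have "(1/2::real) ^ (i + n) \<le> (1/2) ^ n"
        by (intro power_decreasing) auto
      then show "energy W (h (i + n)) \<le> m + ennreal e"
        using n by (intro order_trans[OF h_energy] add_left_mono ennreal_leI) linarith
    qed measurable
  qed
  show thesis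
  proof (rule that)
    show "u \<in> borel_measurable M"
      unfolding u_def by measurable
    show "\<psi> y \<le> u y" for y
      by (simp add: u_def)
    show "u y = 0" if "y \<notin> \<Omega>" for y
      using that by (simp add: u_def S_def h_0 \<psi>\<Omega>)
    show "energy W u < top"
      using u_energy m_fin by (rule le_less_trans)
    show "energy W u \<le> energy W v"
      if "v \<in> borel_measurable M" "\<And>y. \<psi> y \<le> v y" "\<And>y. y \<notin> \<Omega> \<Longrightarrow> v y = 0" for v
      using u_energy m_le[of v] that by (simp add: adm_def order_trans)
  qed
qed

section \<open>A Hardy inequality for superlevel sets\<close>

lemma kern_finite: "fst p \<noteq> snd p \<Longrightarrow> kern p < top"
  using weight_bounds(1)[of "fst p" "snd p"] by (simp add: kern_def less_top[symmetric] del: mult_eq_0_iff)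

lemma kern_lower_bound:
  assumes "x \<noteq> y" "emeasure M (ball_pair x y) * ennreal (dist x y powr s) \<le> c"
  shows "1 \<le> c * kern (x, y)"
proof -
  let ?w = "emeasure M (ball_pair x y) * ennreal (dist x y powr s)"
  have "1 = ?w * inverse ?w"
    using weight_bounds[OF assms(1)] ennreal_divide_self[of ?w] by (simp add: divide_ennreal_def less_top)
  also have "\<dots> \<le> c * inverse ?w"
    using assms(2) by (rule mult_right_mono) simp
  finally show ?thesis
    by (simp add: kern_def)
qed

text \<open>Let \<open>e k\<close> be the energy between the annuli \<open>A k\<close> and
  \<open>A (Suc k)\<close>. From one annulus to the next the average of \<open>v\<close> grows by at
  most a multiple of \<open>e k\<close>, and it starts from 0 outside the ball, so all averages stay
  below \<open>L\<close>. Where \<open>v\<close> exceeds \<open>L + \<theta>\<close>, it differs by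
  at least \<open>\<theta>\<close> from the average over the previous annulus, and this difference
  is again paid for by \<open>e k\<close>. Only the second point of a pair has to lie in the ball,
  which makes the bound directly applicable to the energy of a superminimizer.\<close>

lemma superlevel_hardy:
  assumes conn: "connected (UNIV :: 'a set)" and R: "0 < R" and far: "3 / 2 * R \<le> dist x0 z"
    and m: "0 < m" and lower: "\<And>\<rho>. 0 < \<rho> \<Longrightarrow> \<rho> \<le> R \<Longrightarrow> ennreal (m * \<rho> powr s) \<le> emeasure M (ball x0 \<rho>)"
    and v [measurable]: "v \<in> borel_measurable M" and v0: "\<And>y. 0 \<le> v y"
    and vR: "\<And>y. y \<notin> ball x0 R \<Longrightarrow> v y = 0"
    and I: "energy (\<lambda>p. kern p * indicator (ball x0 R) (snd p)) v \<le> I"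
    and L: "0 \<le> L" "ennreal (3 * C ^ 9 / m) * I \<le> ennreal L" and \<theta>: "0 < \<theta>"
  shows "(\<integral>\<^sup>+y. ennreal (dist x0 y powr - s) * indicator {y. L + \<theta> < v y} y \<partial>M) \<le> ennreal (6 * C ^ 6 / \<theta>) * I"
proof -
  \<comment> \<open>\<open>A 0\<close> will be the annulus just outside \<open>ball x0 R\<close>,
    where \<open>v\<close> vanishes; all later annuli lie inside.\<close>
  define r where "r k = R / 2 ^ k" for k :: nat
  have r: "0 < r k" "r k \<le> R" "2 * r (Suc k) = r k" for k
    using R by (simp_all add: r_def field_simps)
  have r_anti: "r j \<le> r i" if "i \<le> j" for i j
    using that R unfolding r_def by (intro divide_left_mono power_increasing) auto
  define A where "A k = ball x0 (2 * r k) - ball x0 (r k)" for k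
  have [measurable]: "A k \<in> sets M" for k
    by (simp add: A_def)
  define a b where "a k = measure M (A k)" and "b k = measure M (ball x0 (r k))" for k
  have b: "emeasure M (ball x0 (r k)) = ennreal (b k)" "0 < b k" for k
  proof -
    show 1: "emeasure M (ball x0 (r k)) = ennreal (b k)"
      unfolding b_def using emeasure_ball_finite[OF r(1), of x0 k] by (intro emeasure_eq_ennreal_measure) auto
    show "0 < b k"
      using emeasure_ball_pos[OF r(1)[of k], of x0] unfolding 1 by simp
  qed
  have a: "emeasure M (A k) = ennreal (a k)" for k
  proof -
    have "emeasure M (A k) \<le> emeasure M (ball x0 (2 * r k))"
      by (intro emeasure_mono) (auto simp: A_def)
    also have "\<dots> < top"
      using r(1) by (intro emeasure_ball_finite) auto
    finally show ?thesis
      unfolding a_def by (intro emeasure_eq_ennreal_measure) auto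
  qed
  have mass: "emeasure M (ball x0 (2 * r k)) \<le> ennreal (C ^ 3 * a k)" for k
  proof -
    have "emeasure M (ball x0 (2 * r k)) \<le> ennreal (C ^ 3) * emeasure M (A k)"
      unfolding A_def using r[of k] far by (intro annulus_mass[OF conn, of _ _ z]) auto
    then show ?thesis
      using C_ge_1 by (simp add: a ennreal_mult a_def)
  qed
  have ba: "b k \<le> C ^ 3 * a k" for k
  proof -
    have "ennreal (b k) \<le> emeasure M (ball x0 (2 * r k))"
      unfolding b(1)[symmetric] using r(1)[of k] by (intro emeasure_mono) auto
    also note mass
    finally show ?thesis
      using b(2)[of k] C_ge_1 by (subst (asm) ennreal_le_iff) (auto simp: a_def)
  qed
  have ba': "b k \<le> C ^ 3 * a (Suc k)" for k
    using mass[of "Suc k"] b(2)[of k] C_ge_1 by (simp add: r b(1) a_def)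
  have a_pos: "0 < a k" for k
  proof -
    have "0 < C ^ 3 * a k"
      using ba[of k] b(2)[of k] by linarith
    then show ?thesis
      using C_ge_1 by (simp add: zero_less_mult_iff)
  qed
  define f where "f p = kern p * ennreal \<bar>v (fst p) - v (snd p)\<bar>" for p
  have [measurable]: "f \<in> borel_measurable (M \<Otimes>\<^sub>M M)"
    unfolding f_def by measurable
  define e where "e k = (\<integral>\<^sup>+y. indicator (A (Suc k)) y * (\<integral>\<^sup>+x. indicator (A k) x * f (x, y) \<partial>M) \<partial>M)" for k
  have e_eq: "e k = (\<integral>\<^sup>+p. f p * indicator (A k \<times> A (Suc k)) p \<partial>(M \<Otimes>\<^sub>M M))" for k
    unfolding e_def
    by (subst nn_integral_snd[symmetric])
      (auto intro!: nn_integral_cong simp: nn_integral_cmult[symmetric] indicator_times ac_simps)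
  have e_sum: "(\<Sum>k. e k) \<le> I"
  proof -
    have disj: "disjoint_family (\<lambda>k. A k \<times> A (Suc k))"
    proof -
      have "A i \<inter> A j = {}" if "i < j" for i j
      proof -
        have "2 * r j \<le> r i"
          using r_anti[of "Suc i" j] r(3)[of i] that by simp
        then show ?thesis
          by (auto simp: A_def)
      qed
      then have "A i \<inter> A j = {}" if "i \<noteq> j" for i j
        using that by (metis Int_commute linorder_neqE_nat)
      then show ?thesis
        by (auto simp: disjoint_family_on_def)
    qed
    have "(\<Sum>k. e k) = (\<integral>\<^sup>+p. (\<Sum>k. f p * indicator (A k \<times> A (Suc k)) p) \<partial>(M \<Otimes>\<^sub>M M))"
      unfolding e_eq by (subst nn_integral_suminf) auto
    also have "\<dots> = (\<integral>\<^sup>+p. f p * indicator (\<Union>k. A k \<times> A (Suc k)) p \<partial>(M \<Otimes>\<^sub>M M))"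
      using disj by (simp add: suminf_indicator)
    also have "\<dots> \<le> energy (\<lambda>p. kern p * indicator (ball x0 R) (snd p)) v"
    proof -
      have *: "dist x0 y < R" if "y \<in> A (Suc k)" for k y
        using r(2)[of k] r(3)[of k] that by (auto simp: A_def)
      show ?thesis
        unfolding energy_def f_def by (intro nn_integral_mono) (auto split: split_indicator dest: *)
    qed
    finally show ?thesis
      using I by simp
  qed
  define N where "N k y = (\<integral>\<^sup>+x. indicator (A k) x * ennreal \<bar>v x - v y\<bar> \<partial>M)" for k y
  have [measurable]: "N k \<in> borel_measurable M" for k
    unfolding N_def by measurable
  define av where "av k = ennreal (1 / a k) * (\<integral>\<^sup>+x. indicator (A k) x * ennreal (v x) \<partial>M)" for k
  have one: "ennreal (1 / a k) * ennreal (a k) = 1" for k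
    using a_pos[of k] by (simp flip: ennreal_mult)
  have v_le: "ennreal (v y) \<le> av k + ennreal (1 / a k) * N k y" for k y
  proof -
    have "ennreal (v y) = ennreal (1 / a k) * (\<integral>\<^sup>+x. indicator (A k) x * ennreal (v y) \<partial>M)"
      using one[of k] by (simp add: nn_integral_multc a flip: mult.assoc)
    also have "(\<integral>\<^sup>+x. indicator (A k) x * ennreal (v y) \<partial>M) \<le>
        (\<integral>\<^sup>+x. indicator (A k) x * ennreal (v x) + indicator (A k) x * ennreal \<bar>v x - v y\<bar> \<partial>M)"
      using v0 by (intro nn_integral_mono) (auto split: split_indicator simp flip: ennreal_plus intro!: ennreal_leI)
    also have "\<dots> = (\<integral>\<^sup>+x. indicator (A k) x * ennreal (v x) \<partial>M) + N k y"
      unfolding N_def by (rule nn_integral_add) auto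
    finally show ?thesis
      by (simp add: av_def distrib_left mult_left_mono)
  qed
  \<comment> \<open>Points of neighbouring annuli have distance at most \<open>3 * r k\<close>, and
    their \<open>ball_pair\<close> stays within \<open>ball x0 (8 * r k)\<close>. This gives
    \<open>C ^ 3\<close>, and the 3 bounds \<open>3 powr s\<close>. The resulting lower bound on the
    kernel turns oscillation into energy.\<close>
  have N_le: "(\<integral>\<^sup>+y. indicator (A (Suc k)) y * N k y \<partial>M) \<le> ennreal (3 * C ^ 3 * r k powr s * b k) * e k" for k
  proof -
    let ?c = "ennreal (3 * C ^ 3 * r k powr s * b k)"
    have 1: "1 \<le> ?c * kern (x, y)" if x: "x \<in> A k" and y: "y \<in> A (Suc k)" for x y
    proof (rule kern_lower_bound)
      show "x \<noteq> y"
        using x y r(3)[of k] by (auto simp: A_def)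
      have d: "dist x y \<le> 3 * r k"
        using x y dist_triangle[of x y x0] r(3)[of k] by (simp add: A_def dist_commute)
      have "ball_pair x y \<subseteq> ball x0 (2 ^ 3 * r k)"
      proof
        fix w assume "w \<in> ball_pair x y"
        then show "w \<in> ball x0 (2 ^ 3 * r k)"
          using x y d dist_triangle[of x0 w x] dist_triangle[of x0 w y] r(1)[of k] r(3)[of k]
          by (auto simp: ball_pair_def A_def)
      qed
      then have "emeasure M (ball_pair x y) \<le> emeasure M (ball x0 (2 ^ 3 * r k))"
        by (intro emeasure_mono) auto
      also have "\<dots> \<le> ennreal (C ^ 3) * ennreal (b k)"
        unfolding b(1)[symmetric] by (rule emeasure_ball_le_power[OF r(1)])
      finally have "emeasure M (ball_pair x y) \<le> ennreal (C ^ 3) * ennreal (b k)" .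
      moreover have "dist x y powr s \<le> 3 * r k powr s"
      proof -
        have "dist x y powr s \<le> (3 * r k) powr s"
          using d s_pos by (intro powr_mono2) auto
        also have "\<dots> \<le> 3 powr 1 * r k powr s"
          using r(1)[of k] s_less_1 by (simp only: powr_mult) (intro mult_right_mono powr_mono, auto)
        finally show ?thesis
          by simp
      qed
      ultimately have "emeasure M (ball_pair x y) * ennreal (dist x y powr s) \<le>
          ennreal (C ^ 3) * ennreal (b k) * ennreal (3 * r k powr s)"
        by (intro mult_mono ennreal_leI) auto
      also have "\<dots> = ?c"
        using C_ge_1 b(2)[of k] by (simp add: ac_simps flip: ennreal_mult)
      finally show "emeasure M (ball_pair x y) * ennreal (dist x y powr s) \<le> ?c" .
    qed
    have "(\<integral>\<^sup>+y. indicator (A (Suc k)) y * N k y \<partial>M) \<le>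
        (\<integral>\<^sup>+y. ?c * (indicator (A (Suc k)) y * (\<integral>\<^sup>+x. indicator (A k) x * f (x, y) \<partial>M)) \<partial>M)"
    proof (rule nn_integral_mono)
      fix y
      show "indicator (A (Suc k)) y * N k y \<le> ?c * (indicator (A (Suc k)) y * (\<integral>\<^sup>+x. indicator (A k) x * f (x, y) \<partial>M))"
      proof (cases "y \<in> A (Suc k)")
        case True
        have "N k y \<le> (\<integral>\<^sup>+x. ?c * (indicator (A k) x * f (x, y)) \<partial>M)"
          unfolding N_def
        proof (rule nn_integral_mono)
          fix x
          show "indicator (A k) x * ennreal \<bar>v x - v y\<bar> \<le> ?c * (indicator (A k) x * f (x, y))"
            using mult_right_mono[OF 1[OF _ True, of x], of "ennreal \<bar>v x - v y\<bar>"]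
            by (auto simp: f_def mult.assoc split: split_indicator)
        qed
        then show ?thesis
          using True by (simp add: nn_integral_cmult)
      qed simp
    qed
    also have "\<dots> = ?c * e k"
      unfolding e_def by (rule nn_integral_cmult) measurable
    finally show ?thesis .
  qed
  \<comment> \<open>The second factor \<open>C ^ 3\<close> bounds \<open>b k / a k\<close>, the mass
    of the ball against that of the annulus.\<close>
  have NA_le: "(\<integral>\<^sup>+y. indicator (A (Suc k)) y * (ennreal (1 / a k) * N k y) \<partial>M) \<le> ennreal (3 * C ^ 6 * r k powr s) * e k" for k
  proof -
    have "(\<integral>\<^sup>+y. indicator (A (Suc k)) y * (ennreal (1 / a k) * N k y) \<partial>M) =
        ennreal (1 / a k) * (\<integral>\<^sup>+y. indicator (A (Suc k)) y * N k y \<partial>M)"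
      by (simp add: nn_integral_cmult[symmetric] ac_simps)
    also have "\<dots> \<le> ennreal (1 / a k) * (ennreal (3 * C ^ 3 * r k powr s * b k) * e k)"
      by (intro mult_left_mono N_le) auto
    also have "\<dots> = ennreal (3 * C ^ 3 * r k powr s * (b k / a k)) * e k"
      using a_pos[of k] b(2)[of k] C_ge_1 by (simp flip: ennreal_mult mult.assoc)
    also have "\<dots> \<le> ennreal (3 * C ^ 6 * r k powr s) * e k"
    proof (intro mult_right_mono ennreal_leI)
      have "b k / a k \<le> C ^ 3"
        using ba[of k] a_pos[of k] by (simp add: field_simps)
      then have "3 * C ^ 3 * r k powr s * (b k / a k) \<le> 3 * C ^ 3 * r k powr s * C ^ 3"
        using C_ge_1 by (intro mult_left_mono) auto
      then show "3 * C ^ 3 * r k powr s * (b k / a k) \<le> 3 * C ^ 6 * r k powr s"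
        by (simp add: ac_simps flip: power_add)
    qed simp
    finally show ?thesis .
  qed
  have av_Suc: "av (Suc k) \<le> av k + ennreal (3 * C ^ 9 / m) * e k" for k
  proof -
    let ?a = "ennreal (1 / a (Suc k))"
    have "av (Suc k) \<le> ?a * (\<integral>\<^sup>+y. indicator (A (Suc k)) y * av k + indicator (A (Suc k)) y * (ennreal (1 / a k) * N k y) \<partial>M)"
      unfolding av_def[of "Suc k"] using v_le
      by (intro mult_left_mono nn_integral_mono) (auto split: split_indicator)
    also have "\<dots> = ?a * (ennreal (a (Suc k)) * av k + (\<integral>\<^sup>+y. indicator (A (Suc k)) y * (ennreal (1 / a k) * N k y) \<partial>M))"
      by (subst nn_integral_add) (auto simp: nn_integral_multc a)
    also have "\<dots> \<le> ?a * (ennreal (a (Suc k)) * av k + ennreal (3 * C ^ 6 * r k powr s) * e k)"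
      by (intro mult_left_mono add_left_mono NA_le) auto
    also have "\<dots> = av k + ennreal (1 / a (Suc k) * (3 * C ^ 6 * r k powr s)) * e k"
      using one[of "Suc k"] a_pos[of "Suc k"] C_ge_1 by (simp add: distrib_left flip: mult.assoc ennreal_mult)
    \<comment> \<open>The third factor \<open>C ^ 3\<close> compares \<open>b k\<close> with
      \<open>a (Suc k)\<close>. Here the lower bound on the mass of balls enters: it makes the
      increment of the averages independent of the scale.\<close>
    also have "\<dots> \<le> av k + ennreal (3 * C ^ 9 / m) * e k"
    proof (intro add_left_mono mult_right_mono ennreal_leI)
      have "ennreal (m * r k powr s) \<le> ennreal (b k)"
        using lower[OF r(1,2)] by (simp add: b(1))
      then have "m * r k powr s \<le> C ^ 3 * a (Suc k)"
        using ba'[of k] b(2)[of k] by (simp add: ennreal_le_iff)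
      then have "3 * C ^ 6 * (m * r k powr s) \<le> 3 * C ^ 6 * (C ^ 3 * a (Suc k))"
        using C_ge_1 by (intro mult_left_mono) auto
      then show "1 / a (Suc k) * (3 * C ^ 6 * r k powr s) \<le> 3 * C ^ 9 / m"
        using a_pos[of "Suc k"] m by (simp add: field_simps flip: power_add)
    qed simp
    finally show ?thesis .
  qed
  have av_le: "av k \<le> ennreal L" for k
  proof -
    have "av k \<le> (\<Sum>i<k. ennreal (3 * C ^ 9 / m) * e i)"
    proof (induction k)
      case 0
      have "v x = 0" if "x \<in> A 0" for x
        using that by (intro vR) (auto simp: A_def r_def)
      then have "(\<integral>\<^sup>+x. indicator (A 0) x * ennreal (v x) \<partial>M) = (\<integral>\<^sup>+x. 0 \<partial>M)"
        by (intro nn_integral_cong) (auto split: split_indicator)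
      then show ?case
        by (simp add: av_def)
    next
      case (Suc k)
      show ?case
        using order_trans[OF av_Suc[of k] add_right_mono[OF Suc]] by simp
    qed
    also have "\<dots> = ennreal (3 * C ^ 9 / m) * (\<Sum>i<k. e i)"
      by (simp add: sum_distrib_left)
    also have "\<dots> \<le> ennreal (3 * C ^ 9 / m) * I"
      by (intro mult_left_mono order_trans[OF sum_le_suminf e_sum]) auto
    finally show ?thesis
      using L(2) by simp
  qed
  define g where "g y = ennreal (dist x0 y powr - s) * indicator {y. L + \<theta> < v y} y" for y
  have [measurable]: "g \<in> borel_measurable M"
  proof -
    have [measurable]: "(\<lambda>y. dist x0 y) \<in> borel_measurable M"
      by (intro borel_measurable_M borel_measurable_continuous_onI continuous_intros)
    show ?thesis
      unfolding g_def by measurable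
  qed
  \<comment> \<open>Cancelling \<open>L\<close> leaves
    \<open>\<theta> \<le> 1 / a k * N k y\<close>. The factor 2 bounds \<open>2 powr s\<close>,
    which arises in passing from \<open>r (Suc k)\<close> to \<open>r k\<close>.\<close>
  have g_le: "g y * indicator (A (Suc k)) y \<le>
      ennreal (2 / \<theta> * r k powr - s) * (indicator (A (Suc k)) y * (ennreal (1 / a k) * N k y))" for k y
  proof (cases "y \<in> A (Suc k) \<and> L + \<theta> < v y")
    case True
    have "ennreal L + ennreal \<theta> \<le> ennreal (v y)"
      using True L \<theta> by (simp flip: ennreal_plus add: ennreal_leI)
    also have "\<dots> \<le> ennreal L + ennreal (1 / a k) * N k y"
      using v_le[of y k] av_le[of k] by (meson add_right_mono order_trans)
    finally have N: "ennreal \<theta> \<le> ennreal (1 / a k) * N k y"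
      by (simp add: ennreal_add_left_cancel_le)
    have "dist x0 y powr - s \<le> (r (Suc k)) powr - s"
      using True s_pos r(1)[of "Suc k"] by (intro powr_mono2') (auto simp: A_def)
    also have "\<dots> = 2 powr s * r k powr - s"
      using r(1)[of "Suc k"] unfolding r(3)[of k, symmetric] by (simp add: powr_mult powr_minus)
    also have "\<dots> \<le> 2 powr 1 * r k powr - s"
      using s_less_1 by (intro mult_right_mono powr_mono) auto
    finally have d: "dist x0 y powr - s \<le> 2 * r k powr - s"
      by simp
    have "g y * indicator (A (Suc k)) y = ennreal (dist x0 y powr - s)"
      using True by (simp add: g_def)
    also have "\<dots> \<le> ennreal (2 * r k powr - s)"
      using d by (rule ennreal_leI)
    also have "\<dots> = ennreal (2 / \<theta> * r k powr - s) * ennreal \<theta>"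
      using \<theta> by (simp flip: ennreal_mult)
    also have "\<dots> \<le> ennreal (2 / \<theta> * r k powr - s) * (ennreal (1 / a k) * N k y)"
      by (intro mult_left_mono N) auto
    finally show ?thesis
      using True by simp
  next
    case False
    then show ?thesis
      by (auto simp: g_def)
  qed
  \<comment> \<open>The centre lies in no annulus, but \<open>0 powr - s = 0\<close> makes
    \<open>g\<close> vanish there.\<close>
  have "g y \<le> (\<Sum>k. g y * indicator (A (Suc k)) y)" for y
  proof (cases "y \<noteq> x0 \<and> L + \<theta> < v y")
    case True
    then have "y \<in> ball x0 R"
      using vR[of y] L(1) \<theta> by force
    then obtain k where k: "R / 2 ^ Suc k \<le> dist x0 y \<and> dist x0 y < R / 2 ^ k"
      using True ex_dyadic_below[of "dist x0 y" R] by auto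
    then have "y \<in> A (Suc k)"
      unfolding A_def r(3) by (simp add: r_def)
    then have "g y = sum (\<lambda>k. g y * indicator (A (Suc k)) y) {k}"
      by (simp del: sum_mult_indicator)
    also have "\<dots> \<le> (\<Sum>k. g y * indicator (A (Suc k)) y)"
      by (rule sum_le_suminf) auto
    finally show ?thesis .
  next
    case False
    then show ?thesis
      by (auto simp: g_def)
  qed
  then have "(\<integral>\<^sup>+y. g y \<partial>M) \<le> (\<integral>\<^sup>+y. (\<Sum>k. g y * indicator (A (Suc k)) y) \<partial>M)"
    by (intro nn_integral_mono)
  also have "\<dots> = (\<Sum>k. \<integral>\<^sup>+y. g y * indicator (A (Suc k)) y \<partial>M)"
    by (rule nn_integral_suminf) measurable
  also have "\<dots> \<le> (\<Sum>k. ennreal (6 * C ^ 6 / \<theta>) * e k)"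
  proof (intro suminf_le summableI)
    fix k
    have "(\<integral>\<^sup>+y. g y * indicator (A (Suc k)) y \<partial>M) \<le>
        (\<integral>\<^sup>+y. ennreal (2 / \<theta> * r k powr - s) * (indicator (A (Suc k)) y * (ennreal (1 / a k) * N k y)) \<partial>M)"
      by (intro nn_integral_mono g_le)
    also have "\<dots> \<le> ennreal (2 / \<theta> * r k powr - s) * (ennreal (3 * C ^ 6 * r k powr s) * e k)"
      by (subst nn_integral_cmult) (auto intro!: mult_left_mono NA_le)
    also have "\<dots> = ennreal (2 / \<theta> * r k powr - s * (3 * C ^ 6 * r k powr s)) * e k"
      using \<theta> C_ge_1 by (simp flip: ennreal_mult mult.assoc)
    also have "2 / \<theta> * r k powr - s * (3 * C ^ 6 * r k powr s) = 6 * C ^ 6 / \<theta>"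
      using r(1)[of k] by (simp add: powr_minus field_simps)
    finally show "(\<integral>\<^sup>+y. g y * indicator (A (Suc k)) y \<partial>M) \<le> ennreal (6 * C ^ 6 / \<theta>) * e k" .
  qed
  also have "\<dots> \<le> ennreal (6 * C ^ 6 / \<theta>) * I"
    using e_sum by (simp add: ennreal_suminf_cmult mult_left_mono)
  finally show ?thesis
    by (simp add: g_def)
qed

section \<open>The centre is a null point; density at the centre\<close>

text \<open>Each annulus carries a fixed fraction of the ball, so the masses \<open>b k\<close> are
  at most \<open>C ^ 3\<close> times their decrements, and the decrements tend to 0 because
  \<open>b\<close> decreases and converges. Hence changing a function at the centre alone does not
  affect its energy.\<close>

lemma emeasure_singleton_eq_0:
  assumes conn: "connected (UNIV :: 'a set)" and ne: "z \<noteq> x0"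
  shows "emeasure M {x0} = 0"
proof -
  define r where "r k = dist x0 z / 2 / 2 ^ k" for k :: nat
  have r: "0 < r k" "2 * r (Suc k) = r k" "3 / 2 * r k \<le> dist x0 z" for k
  proof -
    have "dist x0 z / 2 / 2 ^ k \<le> dist x0 z / 2 / 1"
      by (intro divide_left_mono) auto
    then show "3 / 2 * r k \<le> dist x0 z"
      using zero_le_dist[of x0 z] unfolding r_def by linarith
  qed (use ne in \<open>simp_all add: r_def\<close>)
  define b where "b k = measure M (ball x0 (r k))" for k
  have b: "emeasure M (ball x0 (r k)) = ennreal (b k)" for k
    unfolding b_def using emeasure_ball_finite[OF r(1), of x0 k] by (intro emeasure_eq_ennreal_measure) auto
  have Suc_le: "b (Suc k) \<le> b k" for k
  proof -
    have "emeasure M (ball x0 (r (Suc k))) \<le> emeasure M (ball x0 (r k))"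
      using r(1)[of "Suc k"] r(2)[of k] by (intro emeasure_mono subset_ball) auto
    then show ?thesis
      by (simp add: b) (simp add: b_def)
  qed
  have mass: "b k \<le> C ^ 3 * (b k - b (Suc k))" for k
  proof -
    have "emeasure M (ball x0 (2 * r (Suc k))) \<le> ennreal (C ^ 3) * emeasure M (ball x0 (2 * r (Suc k)) - ball x0 (r (Suc k)))"
      using r by (intro annulus_mass[OF conn, of _ _ z])
    also have "emeasure M (ball x0 (2 * r (Suc k)) - ball x0 (r (Suc k))) = ennreal (b k - b (Suc k))"
      using r(1)[of "Suc k"] r(2)[of k]
      by (subst emeasure_Diff) (auto simp: b ennreal_minus b_def intro!: subset_ball)
    also have "ennreal (C ^ 3) * ennreal (b k - b (Suc k)) = ennreal (C ^ 3 * (b k - b (Suc k)))"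
      using C_ge_1 Suc_le by (simp add: ennreal_mult)
    finally show ?thesis
      using C_ge_1 Suc_le[of k] unfolding r(2) b by (subst (asm) ennreal_le_iff) auto
  qed
  have "decseq b"
    using Suc_le by (simp add: decseq_Suc_iff)
  then obtain l where l: "b \<longlonglongrightarrow> l"
    using decseq_convergent[of b 0] by (auto simp: b_def)
  have "(\<lambda>k. C ^ 3 * (b k - b (Suc k))) \<longlonglongrightarrow> C ^ 3 * (l - l)"
    by (intro tendsto_intros l LIMSEQ_Suc)
  then have "b \<longlonglongrightarrow> 0"
    by (intro tendsto_sandwich[of "\<lambda>_. 0" b sequentially "\<lambda>k. C ^ 3 * (b k - b (Suc k))"] always_eventually allI mass)
      (auto simp: b_def)
  then have "(\<lambda>k. ennreal (b k)) \<longlonglongrightarrow> ennreal 0"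
    by (rule tendsto_ennrealI)
  moreover have "emeasure M {x0} \<le> ennreal (b k)" for k
    unfolding b[symmetric] using r(1)[of k] by (intro emeasure_mono) auto
  ultimately have "emeasure M {x0} \<le> ennreal 0"
    by (intro LIMSEQ_le_const[where X = "\<lambda>k. ennreal (b k)"]) auto
  then show ?thesis
    by simp
qed

lemma dist_borel_measurable [measurable]: "(\<lambda>y. dist x0 y) \<in> borel_measurable M"
  by (intro borel_measurable_M borel_measurable_continuous_onI continuous_intros)

text \<open>Away from the centre the weight is at least \<open>r powr - s\<close> in
  \<open>ball x0 r\<close>. By Chebyshev the mass of \<open>S\<close> there is at most
  \<open>r powr s\<close> times the integral \<open>G r\<close> over that ball, and the lower bound
  on the ball absorbs \<open>r powr s\<close>. \<open>G r\<close> tends to 0 because the centre is a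
  null point.\<close>

lemma density_zero:
  assumes S [measurable]: "S \<in> sets M" and R: "0 < R" and m: "0 < m"
    and lower: "\<And>\<rho>. 0 < \<rho> \<Longrightarrow> \<rho> \<le> R \<Longrightarrow> ennreal (m * \<rho> powr s) \<le> emeasure M (ball x0 \<rho>)"
    and null: "emeasure M {x0} = 0"
    and fin: "(\<integral>\<^sup>+y. ennreal (dist x0 y powr - s) * indicator S y \<partial>M) < top"
  shows "((\<lambda>r. emeasure M (S \<inter> ball x0 r) / emeasure M (ball x0 r)) \<longlongrightarrow> 0) (at_right 0)"
proof -
  define f where "f y = ennreal (dist x0 y powr - s) * indicator S y" for y
  have [measurable]: "f \<in> borel_measurable M"
    unfolding f_def by measurable
  define G where "G r = (\<integral>\<^sup>+y. f y * indicator (ball x0 r) y \<partial>M)" for r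
  have ne: "AE y in M. y \<noteq> x0"
    using null by (intro AE_I[of _ _ "{x0}"]) (auto intro: closed_in_sets)
  have "(\<lambda>n. G (1 / real (Suc n))) \<longlonglongrightarrow> (\<integral>\<^sup>+y. 0 \<partial>M)"
    unfolding G_def
  proof (rule nn_integral_dominated_convergence[where w = f])
    show "(\<integral>\<^sup>+y. f y \<partial>M) < \<infinity>"
      using fin by (simp add: f_def)
    show "AE y in M. (\<lambda>n. f y * indicator (ball x0 (1 / real (Suc n))) y) \<longlonglongrightarrow> 0"
      using ne
    proof eventually_elim
      case (elim y)
      then obtain N where N: "inverse (real (Suc N)) < dist x0 y"
        using reals_Archimedean[of "dist x0 y"] by auto
      have "f y * indicator (ball x0 (1 / real (Suc n))) y = 0" if "N \<le> n" for n
      proof -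
        have "1 / real (Suc n) \<le> 1 / real (Suc N)"
          using that by (intro divide_left_mono) auto
        then show ?thesis
          using N by (auto simp: inverse_eq_divide)
      qed
      then show ?case
        by (intro tendsto_eventually eventually_sequentiallyI[of N])
    qed
  qed (auto split: split_indicator)
  then have G_lim: "(\<lambda>n. G (1 / real (Suc n))) \<longlonglongrightarrow> 0"
    by simp
  have ratio: "emeasure M (S \<inter> ball x0 r) / emeasure M (ball x0 r) \<le> ennreal (1 / m) * G r" if r: "0 < r" "r \<le> R" for r
  proof -
    have "emeasure M (S \<inter> ball x0 r) = (\<integral>\<^sup>+y. indicator (S \<inter> ball x0 r) y \<partial>M)"
      by simp
    also have "\<dots> \<le> (\<integral>\<^sup>+y. ennreal (r powr s) * (f y * indicator (ball x0 r) y) \<partial>M)"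
    proof (rule nn_integral_mono_AE, use ne in eventually_elim)
      case (elim y)
      show ?case
      proof (cases "y \<in> S \<inter> ball x0 r")
        case True
        then have "dist x0 y powr s \<le> r powr s"
          using s_pos by (intro powr_mono2) auto
        then have "1 \<le> r powr s * dist x0 y powr - s"
          using elim by (simp add: powr_minus field_simps)
        then show ?thesis
          using True by (simp add: f_def flip: ennreal_mult)
      qed auto
    qed
    also have "\<dots> = ennreal (r powr s) * G r"
      unfolding G_def by (rule nn_integral_cmult) measurable
    finally have 1: "emeasure M (S \<inter> ball x0 r) \<le> ennreal (r powr s) * G r" .
    have "emeasure M (S \<inter> ball x0 r) / emeasure M (ball x0 r) \<le>
        (ennreal (r powr s) * G r) * inverse (ennreal (m * r powr s))"
      unfolding divide_ennreal_def by (intro mult_mono 1 ennreal_inverse_antimono lower r) auto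
    also have "\<dots> = ennreal (r powr s * inverse (m * r powr s)) * G r"
    proof -
      have "inverse (ennreal (m * r powr s)) = ennreal (inverse (m * r powr s))"
        using m r by (intro inverse_ennreal) auto
      moreover have "ennreal (r powr s * inverse (m * r powr s)) = ennreal (r powr s) * ennreal (inverse (m * r powr s))"
        using m r by (intro ennreal_mult) auto
      ultimately show ?thesis
        by (simp only: ac_simps)
    qed
    also have "r powr s * inverse (m * r powr s) = 1 / m"
      using m r by (simp add: field_simps)
    finally show ?thesis .
  qed
  have mono: "G r \<le> G r'" if "r \<le> r'" for r r'
    unfolding G_def using that by (intro nn_integral_mono) (auto split: split_indicator)
  show ?thesis
  proof (rule order_tendstoI)
    fix c :: ennreal assume "0 < c"
    have "(\<lambda>n. ennreal (1 / m) * G (1 / real (Suc n))) \<longlonglongrightarrow> ennreal (1 / m) * 0"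
      by (intro ennreal_tendsto_cmult G_lim) auto
    then have "eventually (\<lambda>n. ennreal (1 / m) * G (1 / real (Suc n)) < c) sequentially"
      using \<open>0 < c\<close> by (intro order_tendstoD(2)[where y = 0]) auto
    then obtain n where n: "ennreal (1 / m) * G (1 / real (Suc n)) < c"
      by (auto simp: eventually_sequentially)
    have "eventually (\<lambda>r. r \<in> {0<..<min R (1 / real (Suc n))}) (at_right 0)"
      using R by (intro eventually_at_right_real) auto
    then show "eventually (\<lambda>r. emeasure M (S \<inter> ball x0 r) / emeasure M (ball x0 r) < c) (at_right 0)"
    proof eventually_elim
      case (elim r)
      have "emeasure M (S \<inter> ball x0 r) / emeasure M (ball x0 r) \<le> ennreal (1 / m) * G r"
        using elim by (intro ratio) auto
      also have "\<dots> \<le> ennreal (1 / m) * G (1 / real (Suc n))"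
        using elim by (intro mult_left_mono mono) auto
      finally show ?case
        using n by simp
    qed
  qed simp
qed

section \<open>Cutoff functions\<close>

text \<open>For \<open>0 < \<delta>\<close> the profile drops from 1 to 0 between
  \<open>\<delta>\<close> and \<open>3 / 2 * \<delta>\<close>. Stopping short of
  \<open>2 * \<delta>\<close> keeps the closure of the support inside
  \<open>ball x0 (2 * \<delta>)\<close>, as the condenser capacity demands.\<close>

definition cutoff :: "'a \<Rightarrow> real \<Rightarrow> 'a \<Rightarrow> real" where
  "cutoff x0 \<delta> y = max 0 (min 1 (3 - 2 * dist x0 y / \<delta>))"

lemma cutoff_nonneg: "0 \<le> cutoff x0 \<delta> y" and cutoff_le_1: "cutoff x0 \<delta> y \<le> 1"
  by (simp_all add: cutoff_def)

lemma cutoff_eq_1: "0 < \<delta> \<Longrightarrow> dist x0 y \<le> \<delta> \<Longrightarrow> cutoff x0 \<delta> y = 1"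
  by (simp add: cutoff_def field_simps)

lemma cutoff_eq_0: "0 < \<delta> \<Longrightarrow> 3 / 2 * \<delta> \<le> dist x0 y \<Longrightarrow> cutoff x0 \<delta> y = 0"
  by (simp add: cutoff_def field_simps)

lemma cutoff_measurable [measurable]: "cutoff x0 \<delta> \<in> borel_measurable M"
  unfolding cutoff_def by measurable

lemma cutoff_diff_le:
  assumes "0 < \<delta>"
  shows "\<bar>cutoff x0 \<delta> x - cutoff x0 \<delta> y\<bar> \<le> min 1 (dist x y / (\<delta> / 2))"
proof -
  have clamp: "\<bar>max 0 (min 1 a) - max 0 (min 1 b)\<bar> \<le> min 1 \<bar>a - b\<bar>" for a b :: real
    by (auto simp: max_def min_def)
  have "\<bar>(3 - 2 * dist x0 x / \<delta>) - (3 - 2 * dist x0 y / \<delta>)\<bar> = \<bar>dist x0 y - dist x0 x\<bar> / (\<delta> / 2)"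
    using assms by (simp add: field_simps abs_if)
  also have "\<dots> \<le> dist x y / (\<delta> / 2)"
    using assms dist_triangle[of x0 x y] dist_triangle[of x0 y x]
    by (intro divide_right_mono) (auto simp: dist_commute)
  finally show ?thesis
    using clamp[of "3 - 2 * dist x0 x / \<delta>" "3 - 2 * dist x0 y / \<delta>"] unfolding cutoff_def by linarith
qed

text \<open>The bound is free of \<open>\<delta>\<close>, as a dominating function must be. If
  \<open>dist x0 y \<le> 4 * \<delta>\<close>, the Lipschitz constant \<open>2 / \<delta>\<close> is
  at most \<open>8 / dist x0 y\<close>. Otherwise the cutoff vanishes at \<open>y\<close>, and also
  at \<open>x\<close> unless \<open>dist x y\<close> exceeds half of \<open>dist x0 y\<close>, where
  the minimum is 1.\<close>

lemma cutoff_diff_le_uniform: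
  assumes \<delta>: "0 < \<delta>" and y: "y \<noteq> x0"
  shows "\<bar>cutoff x0 \<delta> x - cutoff x0 \<delta> y\<bar> \<le> min 1 (dist x y / (dist x0 y / 8))"
proof (cases "dist x0 y \<le> 4 * \<delta>")
  case True
  have "dist x y / (\<delta> / 2) \<le> dist x y / (dist x0 y / 8)"
    using True y \<delta> by (intro divide_left_mono) auto
  then show ?thesis
    using cutoff_diff_le[OF \<delta>, of x0 x y] by (simp add: min_le_iff_disj)
next
  case False
  show ?thesis
  proof (cases "dist x y \<le> dist x0 y / 2")
    case True
    then have "3 / 2 * \<delta> \<le> dist x0 x"
      using False dist_triangle[of x0 y x] \<delta> by (simp add: dist_commute)
    then show ?thesis
      using False \<delta> by (simp add: cutoff_eq_0)
  next
    case False
    then have "1 \<le> dist x y / (dist x0 y / 8)"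
      using y zero_le_dist[of x y] by (simp add: field_simps del: zero_le_dist)
    then show ?thesis
      using cutoff_diff_le[OF \<delta>, of x0 x y] by simp
  qed
qed

text \<open>The integrand vanishes unless one of the two points lies in
  \<open>ball x0 (2 * r)\<close>; \<open>kern_bound\<close> at scale \<open>r / 2\<close> integrates
  out the other. The constant 4 is 2 for the choice of the point times a bound for
  \<open>2 powr s\<close>, and \<open>C\<close> is one doubling. Both capacity estimates for balls
  and points test with this function.\<close>

lemma energy_cutoff_le:
  assumes r: "0 < r"
  shows "energy kern (cutoff x0 r) \<le> ennreal (4 * C * kern_const * r powr - s) * emeasure M (ball x0 r)"
proof -
  let ?B = "ball x0 (2 * r)"
  define h where "h p = ennreal (min 1 (dist (fst p) (snd p) / (r / 2))) * kern p" for p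
  have [measurable]: "h \<in> borel_measurable (M \<Otimes>\<^sub>M M)"
    unfolding h_def by measurable
  let ?c = "ennreal (kern_const * (r / 2) powr - s)"
  have h_le: "(\<integral>\<^sup>+x. h (x, y) \<partial>M) \<le> ?c" for y
    unfolding h_def using kern_bound[of "r / 2" y] r by simp
  have h_comm: "h (x, y) = h (y, x)" for x y
    by (simp add: h_def dist_commute kern_commute[of x y])
  have out: "cutoff x0 r x = 0" if "x \<notin> ?B" for x
    using that r by (intro cutoff_eq_0) auto
  have "energy kern (cutoff x0 r) \<le> (\<integral>\<^sup>+p. h p * indicator ?B (fst p) + h p * indicator ?B (snd p) \<partial>(M \<Otimes>\<^sub>M M))"
    unfolding energy_def
  proof (rule nn_integral_mono)
    fix p
    have "kern p * ennreal \<bar>cutoff x0 r (fst p) - cutoff x0 r (snd p)\<bar> \<le> h p"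
      unfolding h_def by (subst mult.commute) (intro mult_right_mono ennreal_leI cutoff_diff_le r, simp)
    then show "kern p * ennreal \<bar>cutoff x0 r (fst p) - cutoff x0 r (snd p)\<bar> \<le>
        h p * indicator ?B (fst p) + h p * indicator ?B (snd p)"
      using out[of "fst p"] out[of "snd p"] by (cases "fst p \<in> ?B"; cases "snd p \<in> ?B") (auto simp: add_increasing)
  qed
  also have "\<dots> = (\<integral>\<^sup>+p. h p * indicator ?B (fst p) \<partial>(M \<Otimes>\<^sub>M M)) + (\<integral>\<^sup>+p. h p * indicator ?B (snd p) \<partial>(M \<Otimes>\<^sub>M M))"
    by (rule nn_integral_add) auto
  also have "(\<integral>\<^sup>+p. h p * indicator ?B (fst p) \<partial>(M \<Otimes>\<^sub>M M)) = (\<integral>\<^sup>+x. (\<integral>\<^sup>+y. h (y, x) \<partial>M) * indicator ?B x \<partial>M)"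
    by (subst sigma_finite_measure.nn_integral_fst[OF sigma_finite_M, symmetric])
      (auto simp: nn_integral_multc h_comm intro!: nn_integral_cong)
  also have "(\<integral>\<^sup>+p. h p * indicator ?B (snd p) \<partial>(M \<Otimes>\<^sub>M M)) = (\<integral>\<^sup>+x. (\<integral>\<^sup>+y. h (y, x) \<partial>M) * indicator ?B x \<partial>M)"
    by (subst nn_integral_snd[symmetric]) (auto simp: nn_integral_multc)
  also have "(\<integral>\<^sup>+x. (\<integral>\<^sup>+y. h (y, x) \<partial>M) * indicator ?B x \<partial>M) + (\<integral>\<^sup>+x. (\<integral>\<^sup>+y. h (y, x) \<partial>M) * indicator ?B x \<partial>M)
      \<le> (\<integral>\<^sup>+x. ?c * indicator ?B x \<partial>M) + (\<integral>\<^sup>+x. ?c * indicator ?B x \<partial>M)"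
    by (intro add_mono nn_integral_mono mult_right_mono h_le) auto
  also have "\<dots> = 2 * ?c * emeasure M ?B"
    by (simp only: nn_integral_cmult_indicator ball_in_sets mult_2 distrib_right)
  also have "\<dots> \<le> 2 * ?c * (ennreal C * emeasure M (ball x0 r))"
    by (intro mult_left_mono emeasure_ball_double r) auto
  also have "\<dots> = ennreal (2 * (kern_const * (r / 2) powr - s) * C) * emeasure M (ball x0 r)"
    using C_ge_1 kern_const_pos by (simp add: ennreal_mult mult.assoc)
  also have "\<dots> \<le> ennreal (4 * C * kern_const * r powr - s) * emeasure M (ball x0 r)"
  proof (intro mult_right_mono ennreal_leI)
    have "(r / 2) powr - s = 2 powr s * r powr - s"
      using r by (simp add: powr_divide powr_minus field_simps)
    also have "\<dots> \<le> 2 powr 1 * r powr - s"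
      using s_less_1 by (intro mult_right_mono powr_mono) auto
    finally have "(2 * kern_const * C) * (r / 2) powr - s \<le> (2 * kern_const * C) * (2 * r powr - s)"
      using kern_const_pos C_ge_1 by (intro mult_left_mono) auto
    then show "2 * (kern_const * (r / 2) powr - s) * C \<le> 4 * C * kern_const * r powr - s"
      by (simp add: algebra_simps)
  qed simp
  finally show ?thesis .
qed

section \<open>Localization at the centre and the exploding obstacle\<close>

text \<open>By the product rule the increment of \<open>w * cutoff\<close> is at most that of
  \<open>w\<close> plus \<open>w y\<close> times that of the cutoff. The second part, bounded
  uniformly in the scale, integrates in \<open>x\<close> to a multiple of the Hardy integrand
  \<open>dist x0 y powr - s * w y\<close>. At \<open>x0\<close> every cutoff is 1, so
  \<open>w x0 = 0\<close> gives convergence to 0 at that point too.\<close>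

lemma energy_mult_cutoff_tendsto_0:
  assumes w [measurable]: "w \<in> borel_measurable M" and w01: "\<And>y. 0 \<le> w y"
    and wx0: "w x0 = 0" and fin: "energy kern w < top"
    and hardy: "(\<integral>\<^sup>+y. ennreal (dist x0 y powr - s) * ennreal (w y) \<partial>M) < top"
  shows "(\<lambda>n. energy kern (\<lambda>y. w y * cutoff x0 (1 / real (Suc n)) y)) \<longlonglongrightarrow> 0"
proof -
  define D where "D p = kern p * ennreal \<bar>w (fst p) - w (snd p)\<bar> +
      ennreal (w (snd p)) * (ennreal (min 1 (dist (fst p) (snd p) / (dist x0 (snd p) / 8))) * kern p)" for p
  have [measurable]: "D \<in> borel_measurable (M \<Otimes>\<^sub>M M)"
    unfolding D_def by measurable
  have "(\<integral>\<^sup>+p. D p \<partial>(M \<Otimes>\<^sub>M M)) = energy kern w + (\<integral>\<^sup>+y. ennreal (w y) *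
      (\<integral>\<^sup>+x. ennreal (min 1 (dist x y / (dist x0 y / 8))) * kern (x, y) \<partial>M) \<partial>M)"
    unfolding D_def energy_def
    by (subst nn_integral_add) (auto simp: nn_integral_cmult nn_integral_snd[symmetric])
  also have "\<dots> \<le> energy kern w + (\<integral>\<^sup>+y. ennreal (kern_const * 8 powr s) * (ennreal (dist x0 y powr - s) * ennreal (w y)) \<partial>M)"
  proof (intro add_left_mono nn_integral_mono)
    fix y
    show "ennreal (w y) * (\<integral>\<^sup>+x. ennreal (min 1 (dist x y / (dist x0 y / 8))) * kern (x, y) \<partial>M) \<le>
        ennreal (kern_const * 8 powr s) * (ennreal (dist x0 y powr - s) * ennreal (w y))"
    proof (cases "y = x0")
      case False
      have "(\<integral>\<^sup>+x. ennreal (min 1 (dist x y / (dist x0 y / 8))) * kern (x, y) \<partial>M) \<le> ennreal (kern_const * (dist x0 y / 8) powr - s)"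
        using False by (intro kern_bound) auto
      also have "kern_const * (dist x0 y / 8) powr - s = kern_const * 8 powr s * dist x0 y powr - s"
        using False by (simp add: powr_divide powr_minus field_simps)
      finally show ?thesis
        using kern_const_pos by (simp add: ennreal_mult' mult_left_mono ac_simps)
    qed (simp add: wx0)
  qed
  also have "\<dots> = energy kern w + ennreal (kern_const * 8 powr s) * (\<integral>\<^sup>+y. ennreal (dist x0 y powr - s) * ennreal (w y) \<partial>M)"
    by (subst nn_integral_cmult) auto
  also have "\<dots> < top"
    using fin hardy by (simp add: ennreal_mult_less_top)
  finally have D_fin: "(\<integral>\<^sup>+p. D p \<partial>(M \<Otimes>\<^sub>M M)) < \<infinity>"
    by simp
  have "(\<lambda>n. energy kern (\<lambda>y. w y * cutoff x0 (1 / real (Suc n)) y)) \<longlonglongrightarrow> (\<integral>\<^sup>+p. 0 \<partial>(M \<Otimes>\<^sub>M M))"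
    unfolding energy_def
  proof (rule nn_integral_dominated_convergence[where w = D])
    show "AE p in M \<Otimes>\<^sub>M M. kern p * ennreal \<bar>w (fst p) * cutoff x0 (1 / real (Suc n)) (fst p) -
        w (snd p) * cutoff x0 (1 / real (Suc n)) (snd p)\<bar> \<le> D p" for n
    proof (rule AE_I2)
      fix p :: "'a \<times> 'a"
      let ?\<eta> = "cutoff x0 (1 / real (Suc n))"
      obtain x y where p: "p = (x, y)"
        by (cases p)
      have "\<bar>w x * ?\<eta> x - w y * ?\<eta> y\<bar> = \<bar>?\<eta> x * (w x - w y) + w y * (?\<eta> x - ?\<eta> y)\<bar>"
        by (simp add: algebra_simps)
      also have "\<dots> \<le> \<bar>?\<eta> x\<bar> * \<bar>w x - w y\<bar> + w y * \<bar>?\<eta> x - ?\<eta> y\<bar>"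
        using w01[of y] by (intro order_trans[OF abs_triangle_ineq]) (auto simp: abs_mult)
      also have "\<dots> \<le> \<bar>w x - w y\<bar> + w y * min 1 (dist x y / (dist x0 y / 8))"
      proof (intro add_mono)
        show "\<bar>?\<eta> x\<bar> * \<bar>w x - w y\<bar> \<le> \<bar>w x - w y\<bar>"
          using cutoff_nonneg[of x0 _ x] cutoff_le_1[of x0 _ x] by (intro mult_left_le_one_le) auto
        show "w y * \<bar>?\<eta> x - ?\<eta> y\<bar> \<le> w y * min 1 (dist x y / (dist x0 y / 8))"
        proof (cases "y = x0")
          case False
          then show ?thesis
            by (intro mult_left_mono cutoff_diff_le_uniform w01) auto
        qed (simp add: wx0)
      qed
      finally have "kern p * ennreal \<bar>w x * ?\<eta> x - w y * ?\<eta> y\<bar> \<le>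
          kern p * ennreal (\<bar>w x - w y\<bar> + w y * min 1 (dist x y / (dist x0 y / 8)))"
        by (intro mult_left_mono ennreal_leI) auto
      also have "\<dots> = D p"
        using w01[of y] by (simp add: D_def p distrib_left ennreal_mult ennreal_plus ac_simps)
      finally show "kern p * ennreal \<bar>w (fst p) * ?\<eta> (fst p) - w (snd p) * ?\<eta> (snd p)\<bar> \<le> D p"
        by (simp add: p)
    qed
    have lim: "(\<lambda>n. w y * cutoff x0 (1 / real (Suc n)) y) \<longlonglongrightarrow> 0" for y
    proof (cases "y = x0")
      case False
      then obtain N where N: "inverse (real (Suc N)) < dist x0 y / 2"
        using reals_Archimedean[of "dist x0 y / 2"] by auto
      have "w y * cutoff x0 (1 / real (Suc n)) y = 0" if "N \<le> n" for n
      proof -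
        have "1 / real (Suc n) \<le> 1 / real (Suc N)"
          using that by (intro divide_left_mono) auto
        moreover have "0 < 1 / real (Suc n)"
          by simp
        ultimately have "cutoff x0 (1 / real (Suc n)) y = 0"
          using N unfolding inverse_eq_divide by (intro cutoff_eq_0) linarith+
        then show ?thesis
          by simp
      qed
      then show ?thesis
        by (intro tendsto_eventually eventually_sequentiallyI[of N])
    qed (simp add: wx0)
    show "AE p in M \<Otimes>\<^sub>M M. (\<lambda>n. kern p * ennreal \<bar>w (fst p) * cutoff x0 (1 / real (Suc n)) (fst p) -
        w (snd p) * cutoff x0 (1 / real (Suc n)) (snd p)\<bar>) \<longlonglongrightarrow> 0"
    proof (rule AE_I2)
      fix p :: "'a \<times> 'a"
      show "(\<lambda>n. kern p * ennreal \<bar>w (fst p) * cutoff x0 (1 / real (Suc n)) (fst p) -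
        w (snd p) * cutoff x0 (1 / real (Suc n)) (snd p)\<bar>) \<longlonglongrightarrow> 0"
      proof (cases "fst p = snd p")
        case False
        have "(\<lambda>n. kern p * ennreal \<bar>w (fst p) * cutoff x0 (1 / real (Suc n)) (fst p) -
            w (snd p) * cutoff x0 (1 / real (Suc n)) (snd p)\<bar>) \<longlonglongrightarrow> kern p * ennreal \<bar>0 - 0\<bar>"
          by (intro ennreal_tendsto_cmult kern_finite False tendsto_ennrealI tendsto_intros lim)
        then show ?thesis
          by simp
      qed simp
    qed
  qed (use D_fin in measurable)
  then show ?thesis
    by simp
qed

lemma energy_add_le:
  assumes [measurable]: "W \<in> borel_measurable (M \<Otimes>\<^sub>M M)" "f \<in> borel_measurable M" "g \<in> borel_measurable M"
  shows "energy W (\<lambda>y. f y + g y) \<le> energy W f + energy W g"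
proof -
  have "W p * ennreal \<bar>(f a + g a) - (f b + g b)\<bar> \<le> W p * ennreal \<bar>f a - f b\<bar> + W p * ennreal \<bar>g a - g b\<bar>" for a b p
    unfolding distrib_left[symmetric]
    by (intro mult_left_mono) (auto simp flip: ennreal_plus intro!: ennreal_leI)
  then show ?thesis
    unfolding energy_def by (subst nn_integral_add[symmetric]) (auto intro!: nn_integral_mono)
qed

text \<open>A series of cut off copies of \<open>w\<close> with energies below
  \<open>(1/2) ^ k\<close> has finite energy. Near the centre the first \<open>k\<close> cutoffs all
  equal 1, so where \<open>w\<close> is 1 the sum is at least \<open>k\<close>.\<close>

lemma exploding_function:
  assumes w [measurable]: "w \<in> borel_measurable M" and w01: "\<And>y. 0 \<le> w y"
    and wx0: "w x0 = 0" and fin: "energy kern w < top"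
    and hardy: "(\<integral>\<^sup>+y. ennreal (dist x0 y powr - s) * ennreal (w y) \<partial>M) < top"
  obtains \<psi> where "\<psi> \<in> borel_measurable M" "\<And>y. 0 \<le> \<psi> y" "\<And>y. w y = 0 \<Longrightarrow> \<psi> y = 0" "energy kern \<psi> < top"
    "\<And>k::nat. \<exists>\<delta>>0. \<forall>y. w y = 1 \<longrightarrow> dist x0 y < \<delta> \<longrightarrow> real k \<le> \<psi> y"
proof -
  have "\<exists>n\<ge>k. energy kern (\<lambda>y. w y * cutoff x0 (1 / real (Suc n)) y) < ennreal ((1/2) ^ k)" for k :: nat
  proof -
    have "eventually (\<lambda>n. energy kern (\<lambda>y. w y * cutoff x0 (1 / real (Suc n)) y) < ennreal ((1/2) ^ k)) sequentially"
      by (rule order_tendstoD(2)[OF energy_mult_cutoff_tendsto_0[OF assms]]) simp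
    then obtain N where N: "\<And>n. N \<le> n \<Longrightarrow> energy kern (\<lambda>y. w y * cutoff x0 (1 / real (Suc n)) y) < ennreal ((1/2) ^ k)"
      unfolding eventually_sequentially by blast
    show ?thesis
      by (intro exI[of _ "max k N"] conjI N) auto
  qed
  \<comment> \<open>\<open>k \<le> n k\<close> forces the scales to shrink, so at each point other
    than \<open>x0\<close> only finitely many terms are nonzero; at \<open>x0\<close> all terms
    vanish.\<close>
  then obtain n where n: "\<And>k. k \<le> n k"
      "\<And>k. energy kern (\<lambda>y. w y * cutoff x0 (1 / real (Suc (n k))) y) < ennreal ((1/2) ^ k)"
    by metis
  define \<delta> where "\<delta> k = 1 / real (Suc (n k))" for k
  have \<delta>: "0 < \<delta> k" "\<delta> k \<le> 1 / real (Suc k)" for k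
    using n(1)[of k] by (auto simp: \<delta>_def intro!: divide_left_mono)
  define f where "f k y = w y * cutoff x0 (\<delta> k) y" for k y
  have [measurable]: "f k \<in> borel_measurable M" for k
    unfolding f_def by measurable
  have f_nonneg: "0 \<le> f k y" for k y
    using w01 cutoff_nonneg by (simp add: f_def)
  have f_eventually: "\<exists>N. \<forall>k\<ge>N. f k y = 0" for y
  proof (cases "y = x0")
    case False
    then obtain N where N: "inverse (real (Suc N)) < dist x0 y / 2"
      using reals_Archimedean[of "dist x0 y / 2"] by auto
    have "f k y = 0" if "N \<le> k" for k
    proof -
      have "1 / real (Suc k) \<le> 1 / real (Suc N)"
        using that by (intro divide_left_mono) auto
      then have "cutoff x0 (\<delta> k) y = 0"
        using N \<delta>[of k] by (intro cutoff_eq_0) (auto simp: inverse_eq_divide simp del: of_nat_Suc)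
      then show ?thesis
        by (simp add: f_def)
    qed
    then show ?thesis
      by blast
  qed (simp add: f_def wx0)
  have summ: "summable (\<lambda>k. f k y)" for y
  proof -
    obtain N where "\<forall>k\<ge>N. f k y = 0"
      using f_eventually by blast
    then show ?thesis
      by (intro summable_finite[of "{..<N}"]) (auto simp: not_less)
  qed
  define \<psi> where "\<psi> y = (\<Sum>k. f k y)" for y
  define g where "g N y = (\<Sum>k<N. f k y)" for N y
  have [measurable]: "g N \<in> borel_measurable M" for N
    unfolding g_def by measurable
  have g_energy: "energy kern (g N) \<le> ennreal (2 - 2 * (1/2) ^ N)" for N
  proof (induction N)
    case 0
    then show ?case
      by (simp add: g_def energy_def)
  next
    case (Suc N)
    have "energy kern (g (Suc N)) \<le> energy kern (g N) + energy kern (f N)"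
    proof -
      have "g (Suc N) = (\<lambda>y. g N y + f N y)"
        by (simp add: g_def fun_eq_iff)
      then show ?thesis
        using energy_add_le[of kern "g N" "f N"] by simp
    qed
    also have "\<dots> \<le> ennreal (2 - 2 * (1/2) ^ N) + ennreal ((1/2) ^ N)"
      using n(2)[of N] by (intro add_mono Suc) (simp add: f_def[abs_def] \<delta>_def less_imp_le)
    also have "\<dots> = ennreal (2 - 2 * (1/2) ^ Suc N)"
      by (subst ennreal_plus[symmetric]) (auto simp: power_le_one)
    finally show ?case .
  qed
  have "energy kern \<psi> \<le> ennreal 2"
  proof (rule energy_le_of_tendsto)
    show "AE y in M. (\<lambda>N. g N y) \<longlonglongrightarrow> \<psi> y"
      unfolding g_def \<psi>_def using summ by (intro AE_I2 summable_LIMSEQ)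
    show "energy kern (g N) \<le> ennreal 2" for N
      by (rule order_trans[OF g_energy]) (intro ennreal_leI, simp)
  qed (auto intro: kern_finite)
  then have "energy kern \<psi> < top"
    by (rule le_less_trans) simp
  moreover have "\<psi> \<in> borel_measurable M"
    unfolding \<psi>_def by measurable
  moreover have "0 \<le> \<psi> y" for y
    unfolding \<psi>_def by (intro suminf_nonneg summ f_nonneg)
  moreover have "\<psi> y = 0" if "w y = 0" for y
    using that by (simp add: \<psi>_def f_def)
  moreover have "\<exists>\<epsilon>>0. \<forall>y. w y = 1 \<longrightarrow> dist x0 y < \<epsilon> \<longrightarrow> real k \<le> \<psi> y" for k :: nat
  proof -
    \<comment> \<open>Inserting 1 keeps the minimum meaningful for \<open>k = 0\<close>.\<close>
    define \<epsilon> where "\<epsilon> = Min (insert 1 (\<delta> ` {..<k}))"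
    have "0 < \<epsilon>"
      unfolding \<epsilon>_def using \<delta>(1) by (subst Min_gr_iff) auto
    moreover have "real k \<le> \<psi> y" if y: "w y = 1" "dist x0 y < \<epsilon>" for y
    proof -
      have "f j y = 1" if "j < k" for j
      proof -
        have "\<epsilon> \<le> \<delta> j"
          unfolding \<epsilon>_def using that by (intro Min_le) auto
        then show ?thesis
          using y \<delta>(1)[of j] by (simp add: f_def cutoff_eq_1)
      qed
      then have "real k = (\<Sum>j<k. f j y)"
        by simp
      also have "\<dots> \<le> \<psi> y"
        unfolding \<psi>_def by (intro sum_le_suminf summ) (auto simp: f_nonneg)
      finally show ?thesis .
    qed
    ultimately show ?thesis
      by blast
  qed
  ultimately show thesis
    using that by blast
qed

end

section \<open>Capacities\<close>

locale fractional_space = doubling_space "induced_measure \<mu>" C s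
  for \<mu> :: "'a::polish_space set \<Rightarrow> ennreal" and C s :: real +
  assumes outer: "outer_measure_space UNIV \<mu>"
begin

abbreviation "M \<equiv> induced_measure \<mu>"

lemma \<mu>_eq: "S \<in> sets M \<Longrightarrow> \<mu> S = emeasure M S"
  using emeasure_induced_measure[OF outer, of S] by (simp add: sets_induced_measure[OF outer])

lemma frac_weight_eq: "frac_weight \<mu> s x y = emeasure M (ball_pair x y) * ennreal (dist x y powr s)"
  by (simp add: frac_weight_def \<mu>_eq)

lemma kern_eq: "kern (x, y) = inverse (frac_weight \<mu> s x y)"
  by (simp add: kern_def frac_weight_eq)

lemma energy_eq_iterated:
  assumes [measurable]: "v \<in> borel_measurable M" "W \<in> borel_measurable (M \<Otimes>\<^sub>M M)"
  shows "energy W v = (\<integral>\<^sup>+y. \<integral>\<^sup>+x. W (x, y) * ennreal \<bar>v x - v y\<bar> \<partial>M \<partial>M)"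
  unfolding energy_def by (subst nn_integral_snd[symmetric]) auto

text \<open>An extended real function may be replaced by a real one as long as differences do not
  increase. Truncation to [0,1] and \<open>real_of_ereal\<close> are the two cases.\<close>

lemma energy_le_frac_seminorm:
  assumes [measurable]: "v \<in> borel_measurable M"
    and le: "\<And>x y. ennreal \<bar>v x - v y\<bar> \<le> e2ennreal \<bar>u x - u y\<bar>"
  shows "energy kern v \<le> frac_seminorm \<mu> s UNIV u"
  unfolding frac_seminorm_def energy_eq_iterated[OF assms(1) kern_measurable]
  by (intro nn_integral_mono) (auto simp: kern_eq divide_ennreal_def mult.commute intro!: nn_integral_mono mult_left_mono le)

lemma frac_seminorm_eq_energy:
  assumes [measurable]: "v \<in> borel_measurable M"
  shows "frac_seminorm \<mu> s UNIV (\<lambda>x. ereal (v x)) = energy kern v"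
  unfolding frac_seminorm_def energy_eq_iterated[OF assms kern_measurable]
  by (simp add: kern_eq divide_ennreal_def mult.commute e2ennreal_ereal)

lemma measurable_ereal_restrict_UNIV:
  "v \<in> borel_measurable M \<Longrightarrow> (\<lambda>x. ereal (v x)) \<in> borel_measurable (restrict_space M S)"
  by (intro measurable_restrict_space1) measurable

definition cutoff_const :: real where
  "cutoff_const = 4 * C * kern_const"

lemma cutoff_const_pos: "0 < cutoff_const"
  using C_ge_1 kern_const_pos by (simp add: cutoff_const_def)

lemma condenser_capacity_ball_le:
  assumes r: "0 < r"
  shows "condenser_capacity \<mu> s (ball x0 r) (ball x0 (2 * r)) \<le> ennreal (cutoff_const * r powr - s) * emeasure M (ball x0 r)"
proof -
  let ?u = "\<lambda>x. ereal (cutoff x0 r x)"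
  have e: "frac_seminorm \<mu> s UNIV ?u \<le> ennreal (cutoff_const * r powr - s) * emeasure M (ball x0 r)"
    using energy_cutoff_le[OF r, of x0] by (simp add: frac_seminorm_eq_energy cutoff_const_def)
  also have "\<dots> < top"
    using emeasure_ball_finite[OF r, of x0] by (simp add: ennreal_mult_less_top)
  finally have "?u \<in> frac_hom_sobolev \<mu> s UNIV"
    by (auto simp: frac_hom_sobolev_def intro!: measurable_ereal_restrict_UNIV)
  moreover have "closure {y. ?u y \<noteq> 0} \<subseteq> ball x0 (2 * r)"
  proof -
    have "closure {y. ?u y \<noteq> 0} \<subseteq> cball x0 (3 / 2 * r)"
    proof (intro closure_minimal subsetI)
      fix y assume "y \<in> {y. ?u y \<noteq> 0}"
      then show "y \<in> cball x0 (3 / 2 * r)"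
        using cutoff_eq_0[OF r, of x0 y] by (cases "3 / 2 * r \<le> dist x0 y") auto
    qed simp
    also have "\<dots> \<subseteq> ball x0 (2 * r)"
      using r by (auto simp: subset_iff)
    finally show ?thesis .
  qed
  moreover have "\<exists>U. open U \<and> ball x0 r \<subseteq> U \<and> (\<forall>y\<in>U. ?u y = 1)"
    using cutoff_eq_1[OF r, of x0] by (intro exI[of _ "ball x0 r"]) auto
  ultimately show ?thesis
    unfolding condenser_capacity_def by (intro INF_lower2[where i = ?u and f = "frac_seminorm \<mu> s UNIV", OF _ e]) auto
qed

text \<open>Unlike the condenser capacity, the norm has a zeroth order part, of the order of the
  mass of the ball. For \<open>r \<le> R\<close> the inequality
  \<open>1 \<le> R powr s * r powr - s\<close> brings it into the form of the seminorm part.\<close>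

lemma frac_capacity_singleton_le:
  assumes r: "0 < r" "r \<le> R"
  shows "frac_capacity \<mu> s {x0} \<le> ennreal ((C * R powr s + cutoff_const) * r powr - s) * emeasure M (ball x0 r)"
proof -
  let ?u = "\<lambda>x. ereal (cutoff x0 r x)"
  have "(\<integral>\<^sup>+x\<in>UNIV. e2ennreal \<bar>?u x\<bar> \<partial>M) \<le> (\<integral>\<^sup>+x. indicator (ball x0 (2 * r)) x \<partial>M)"
  proof (rule nn_integral_mono)
    fix x
    show "e2ennreal \<bar>?u x\<bar> * indicator UNIV x \<le> indicator (ball x0 (2 * r)) x"
      using cutoff_eq_0[OF r(1), of x0 x] cutoff_le_1[of x0 r x] cutoff_nonneg[of x0 r x] r
      by (auto split: split_indicator simp: e2ennreal_ereal)
  qed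
  also have "\<dots> \<le> ennreal C * emeasure M (ball x0 r)"
    using emeasure_ball_double[OF r(1)] by simp
  finally have "frac_norm \<mu> s UNIV ?u \<le> ennreal C * emeasure M (ball x0 r) +
      ennreal (cutoff_const * r powr - s) * emeasure M (ball x0 r)"
    unfolding frac_norm_def using energy_cutoff_le[OF r(1), of x0]
    by (intro add_mono) (auto simp: frac_seminorm_eq_energy cutoff_const_def)
  also have "\<dots> = ennreal (C + cutoff_const * r powr - s) * emeasure M (ball x0 r)"
    using C_ge_1 cutoff_const_pos by (simp add: distrib_right)
  also have "\<dots> \<le> ennreal ((C * R powr s + cutoff_const) * r powr - s) * emeasure M (ball x0 r)"
  proof (intro mult_right_mono ennreal_leI)
    have "1 \<le> R powr s * r powr - s"
      using r s_pos powr_mono2[of s r R] by (simp add: powr_minus field_simps)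
    then have "C * 1 \<le> C * (R powr s * r powr - s)"
      using C_ge_1 by (intro mult_left_mono) auto
    then show "C + cutoff_const * r powr - s \<le> (C * R powr s + cutoff_const) * r powr - s"
      by (simp add: algebra_simps)
  qed simp
  finally have e: "frac_norm \<mu> s UNIV ?u \<le> ennreal ((C * R powr s + cutoff_const) * r powr - s) * emeasure M (ball x0 r)" .
  also have "\<dots> < top"
    using emeasure_ball_finite[OF r(1), of x0] by (simp add: ennreal_mult_less_top)
  finally have "?u \<in> frac_sobolev \<mu> s UNIV"
    by (auto simp: frac_sobolev_def intro!: measurable_ereal_restrict_UNIV)
  moreover have "\<exists>U. open U \<and> {x0} \<subseteq> U \<and> (\<forall>y\<in>U. ?u y = 1)"
    using cutoff_eq_1[OF r(1), of x0] r by (intro exI[of _ "ball x0 r"]) auto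
  ultimately show ?thesis
    unfolding frac_capacity_def by (intro INF_lower2[where i = ?u and f = "frac_norm \<mu> s UNIV", OF _ e]) auto
qed

text \<open>The capacity of the point does not depend on the radius, so testing it at every scale up
  to \<open>R\<close> bounds the mass of the ball divided by \<open>r powr s\<close> from below. The
  test at \<open>R\<close> itself shows that the capacity is finite.\<close>

lemma emeasure_ball_lower_bound:
  assumes cap: "0 < frac_capacity \<mu> s {x0}" and R: "0 < R"
  obtains m where "0 < m" "\<And>r. 0 < r \<Longrightarrow> r \<le> R \<Longrightarrow> ennreal (m * r powr s) \<le> emeasure M (ball x0 r)"
proof -
  let ?c = "frac_capacity \<mu> s {x0}" and ?K = "C * R powr s + cutoff_const"
  have K: "0 < ?K"
    using C_ge_1 cutoff_const_pos by (simp add: add_nonneg_pos)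
  have "?c \<le> ennreal (?K * R powr - s) * emeasure M (ball x0 R)"
    using R by (intro frac_capacity_singleton_le) auto
  also have "\<dots> < top"
    using emeasure_ball_finite[OF R, of x0] by (simp add: ennreal_mult_less_top)
  finally obtain c where c: "0 \<le> c" "?c = ennreal c"
    by (cases ?c) auto
  with cap have c_pos: "0 < c"
    by simp
  show thesis
  proof (rule that[of "c / ?K"])
    fix r assume r: "0 < r" "r \<le> R"
    have "ennreal (c / ?K * r powr s) = ennreal (r powr s / ?K) * ?c"
      using c K by (simp add: mult.commute flip: ennreal_mult)
    also have "\<dots> \<le> ennreal (r powr s / ?K) * (ennreal (?K * r powr - s) * emeasure M (ball x0 r))"
      by (intro mult_left_mono frac_capacity_singleton_le r) auto
    also have "\<dots> = ennreal (r powr s / ?K * (?K * r powr - s)) * emeasure M (ball x0 r)"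
      using K by (simp add: ennreal_mult mult.assoc del: times_divide_eq_left times_divide_eq_right)
    also have "r powr s / ?K * (?K * r powr - s) = 1"
    proof -
      have "r powr s * r powr - s = 1"
        using r by (simp add: powr_minus)
      then show ?thesis
        using K by (simp add: field_simps)
    qed
    finally show "ennreal (c / ?K * r powr s) \<le> emeasure M (ball x0 r)"
      by simp
  qed (use c_pos K in simp)
qed

text \<open>Truncating a competitor to [0,1] makes it real-valued, keeps the values 0 and 1, and
  does not raise its energy.\<close>

lemma condenser_test_function:
  assumes "condenser_capacity \<mu> s A F < c"
  obtains v U where "v \<in> borel_measurable M" "\<And>y. 0 \<le> v y" "\<And>y. v y \<le> 1" "\<And>y. y \<notin> F \<Longrightarrow> v y = 0"
    "open U" "A \<subseteq> U" "\<And>y. y \<in> U \<Longrightarrow> v y = 1" "energy kern v < c"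
proof -
  obtain u U where u: "u \<in> frac_hom_sobolev \<mu> s UNIV" and U: "open U" "A \<subseteq> U" "\<forall>y\<in>U. u y = 1"
    and F: "closure {y. u y \<noteq> 0} \<subseteq> F" and c: "frac_seminorm \<mu> s UNIV u < c"
    using assms unfolding condenser_capacity_def INF_less_iff by auto
  define v where "v y = real_of_ereal (max 0 (min 1 (u y)))" for y
  have "u \<in> borel_measurable (restrict_space M UNIV)"
    using u by (simp add: frac_hom_sobolev_def)
  then have [measurable]: "u \<in> borel_measurable M"
    by (simp only: measurable_cong_sets[OF sets_restrict_UNIV refl])
  have v [measurable]: "v \<in> borel_measurable M"
    unfolding v_def by measurable
  have v01: "0 \<le> v y \<and> v y \<le> 1" for y
    unfolding v_def by (cases "u y") (auto simp: max_def min_def one_ereal_def zero_ereal_def)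
  \<comment> \<open>Infinite values are no exception: even for equal ones the difference has
    absolute value \<open>\<infinity>\<close> in \<open>ereal\<close>.\<close>
  have "ennreal \<bar>v x - v y\<bar> \<le> e2ennreal \<bar>u x - u y\<bar>" for x y
    unfolding v_def
    by (cases "u x"; cases "u y")
      (auto simp: max_def min_def e2ennreal_ereal one_ereal_def zero_ereal_def intro!: ennreal_leI)
  then have "energy kern v \<le> frac_seminorm \<mu> s UNIV u"
    by (rule energy_le_frac_seminorm[OF v])
  with c have "energy kern v < c"
    by simp
  moreover have "v y = 0" if "y \<notin> F" for y
  proof -
    have "u y = 0"
      using that F closure_subset[of "{y. u y \<noteq> 0}"] by auto
    then show ?thesis
      by (simp add: v_def)
  qed
  moreover have "v y = 1" if "y \<in> U" for y
    using U(3) that by (simp add: v_def)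
  ultimately show thesis
    using that[of v U] v v01 U by blast
qed

section \<open>Superminimizers\<close>

text \<open>The factors \<open>1\<close> and \<open>2\<close> are those of the two double integrals in \<^const>\<open>frac_functional\<close>.\<close>

definition super_weight :: "'a set \<Rightarrow> 'a \<times> 'a \<Rightarrow> ennreal" where
  "super_weight \<Omega> p = kern p * (indicator \<Omega> (snd p) * (if fst p \<in> \<Omega> then 1 else 2))"

lemma super_weight_measurable [measurable]:
  assumes [measurable]: "\<Omega> \<in> sets M"
  shows "super_weight \<Omega> \<in> borel_measurable (M \<Otimes>\<^sub>M M)"
  unfolding super_weight_def by measurable

lemma super_weight_finite: "fst p \<noteq> snd p \<Longrightarrow> super_weight \<Omega> p < top"
  using kern_finite[of p] by (auto simp: super_weight_def ennreal_mult_less_top split: split_indicator)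

lemma energy_super_weight_le:
  assumes [measurable]: "\<Omega> \<in> sets M" "v \<in> borel_measurable M"
  shows "energy (super_weight \<Omega>) v \<le> 2 * energy kern v"
proof -
  have "super_weight \<Omega> p \<le> 2 * kern p" for p
    by (auto simp: super_weight_def mult.commute split: split_indicator intro: order_trans[OF _ mult_right_mono[of 1 2]])
  then have "energy (super_weight \<Omega>) v \<le> (\<integral>\<^sup>+p. 2 * (kern p * ennreal \<bar>v (fst p) - v (snd p)\<bar>) \<partial>(M \<Otimes>\<^sub>M M))"
    unfolding energy_def mult.assoc[symmetric] by (intro nn_integral_mono mult_right_mono) auto
  also have "\<dots> = 2 * energy kern v"
    unfolding energy_def by (rule nn_integral_cmult) measurable
  finally show ?thesis .
qed

section \<open>Energies as real integrals and the signed functional\<close>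

text \<open>The superminimizer functional subtracts inside iterated signed integrals. Real
  integrands, one for each inner domain \<open>S\<close>, give access to Bochner integration and
  Fubini.\<close>

definition slice :: "'a set \<Rightarrow> 'a set \<Rightarrow> ('a \<Rightarrow> real) \<Rightarrow> 'a \<times> 'a \<Rightarrow> real" where
  "slice \<Omega> S v p = indicator \<Omega> (snd p) * (indicator S (fst p) *
     (\<bar>v (fst p) - v (snd p)\<bar> / enn2real (frac_weight \<mu> s (fst p) (snd p))))"

lemma frac_weight_measurable [measurable]:
  "(\<lambda>p. frac_weight \<mu> s (fst p) (snd p)) \<in> borel_measurable (M \<Otimes>\<^sub>M M)"
proof -
  have "frac_weight \<mu> s (fst p) (snd p) = inverse (kern p)" for p
    by (cases "frac_weight \<mu> s (fst p) (snd p)"; cases "frac_weight \<mu> s (fst p) (snd p) = 0")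
      (auto simp: kern_eq[of "fst p" "snd p", simplified] inverse_ennreal order_le_less)
  then show ?thesis
    by simp
qed

lemma slice_measurable [measurable]:
  assumes [measurable]: "\<Omega> \<in> sets M" "S \<in> sets M" "v \<in> borel_measurable M"
  shows "slice \<Omega> S v \<in> borel_measurable (M \<Otimes>\<^sub>M M)"
  unfolding slice_def by measurable

lemma slice_nonneg: "0 \<le> slice \<Omega> S v p"
  by (simp add: slice_def)

lemma ennreal_slice:
  "ennreal (slice \<Omega> S v p) = indicator \<Omega> (snd p) * indicator S (fst p) * (kern p * ennreal \<bar>v (fst p) - v (snd p)\<bar>)"
proof (cases "fst p = snd p")
  case False
  let ?w = "frac_weight \<mu> s (fst p) (snd p)"
  have "?w \<noteq> 0" "?w \<noteq> top"
    using weight_bounds[OF False] by (simp_all add: frac_weight_eq)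
  then obtain w where w: "0 < w" "?w = ennreal w"
    by (cases ?w) (auto simp: order_le_less)
  then have "ennreal (\<bar>v (fst p) - v (snd p)\<bar> / enn2real ?w) = kern p * ennreal \<bar>v (fst p) - v (snd p)\<bar>"
    using kern_eq[of "fst p" "snd p"] by (simp add: inverse_ennreal divide_inverse ennreal_mult mult.commute)
  then show ?thesis
    by (auto simp: slice_def split: split_indicator)
qed (simp add: slice_def)

lemma slice_energy:
  assumes [measurable]: "\<Omega> \<in> sets M" "v \<in> borel_measurable M" and fin: "energy (super_weight \<Omega>) v < top"
  shows "integrable (M \<Otimes>\<^sub>M M) (slice \<Omega> \<Omega> v)" "integrable (M \<Otimes>\<^sub>M M) (slice \<Omega> (- \<Omega>) v)"
    and "energy (super_weight \<Omega>) v =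
      ennreal ((\<integral>p. slice \<Omega> \<Omega> v p \<partial>(M \<Otimes>\<^sub>M M)) + 2 * (\<integral>p. slice \<Omega> (- \<Omega>) v p \<partial>(M \<Otimes>\<^sub>M M)))"
proof -
  let ?a = "\<lambda>S. \<integral>\<^sup>+p. ennreal (slice \<Omega> S v p) \<partial>(M \<Otimes>\<^sub>M M)"
  have [measurable]: "- \<Omega> \<in> sets M"
    using sets.compl_sets[of \<Omega> M] by (simp add: Compl_eq_Diff_UNIV)
  have "energy (super_weight \<Omega>) v = (\<integral>\<^sup>+p. ennreal (slice \<Omega> \<Omega> v p) + 2 * ennreal (slice \<Omega> (- \<Omega>) v p) \<partial>(M \<Otimes>\<^sub>M M))"
    unfolding energy_def
    by (intro nn_integral_cong) (auto simp: ennreal_slice super_weight_def ac_simps split: split_indicator)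
  also have "\<dots> = ?a \<Omega> + 2 * ?a (- \<Omega>)"
    by (subst nn_integral_add) (auto simp: nn_integral_cmult)
  finally have e: "energy (super_weight \<Omega>) v = ?a \<Omega> + 2 * ?a (- \<Omega>)" .
  have "?a \<Omega> < top" "?a (- \<Omega>) < top"
    using fin unfolding e by (auto simp: ennreal_mult_less_top)
  then show int: "integrable (M \<Otimes>\<^sub>M M) (slice \<Omega> \<Omega> v)" "integrable (M \<Otimes>\<^sub>M M) (slice \<Omega> (- \<Omega>) v)"
    by (auto intro!: integrableI_nonneg simp: slice_nonneg)
  show "energy (super_weight \<Omega>) v =
      ennreal ((\<integral>p. slice \<Omega> \<Omega> v p \<partial>(M \<Otimes>\<^sub>M M)) + 2 * (\<integral>p. slice \<Omega> (- \<Omega>) v p \<partial>(M \<Otimes>\<^sub>M M)))"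
    unfolding e using int
    by (simp add: nn_integral_eq_integral slice_nonneg ennreal_mult integral_nonneg_AE)
qed

text \<open>Fubini for an integrand prescribed only at pairs of points satisfying \<open>P\<close>.
  The exceptional null set is there because a perturbation may be infinite, or nonzero outside
  \<open>\<Omega>\<close>, on a null set.\<close>

lemma ext_set_integral_slices:
  assumes [measurable]: "\<Omega> \<in> sets M" "S \<in> sets M"
    and u: "integrable (M \<Otimes>\<^sub>M M) (slice \<Omega> S u)" and v: "integrable (M \<Otimes>\<^sub>M M) (slice \<Omega> S v)"
    and P: "AE y in M. P y"
    and f: "\<And>x y. P x \<Longrightarrow> P y \<Longrightarrow>
      f x y = ereal ((\<bar>u x - u y\<bar> - \<bar>v x - v y\<bar>) / enn2real (frac_weight \<mu> s x y))"
  shows "ext_set_integral M \<Omega> (\<lambda>y. ext_set_integral M S (\<lambda>x. f x y)) =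
    ereal ((\<integral>p. slice \<Omega> S u p \<partial>(M \<Otimes>\<^sub>M M)) - (\<integral>p. slice \<Omega> S v p \<partial>(M \<Otimes>\<^sub>M M)))"
proof -
  define g where "g x y = (\<bar>u x - u y\<bar> - \<bar>v x - v y\<bar>) / enn2real (frac_weight \<mu> s x y)" for x y
  have g: "slice \<Omega> S u (x, y) - slice \<Omega> S v (x, y) = indicator \<Omega> y * (indicator S x * g x y)" for x y
    by (simp add: slice_def g_def diff_divide_distrib algebra_simps)
  have "integrable (M \<Otimes>\<^sub>M M) (\<lambda>p. slice \<Omega> S u p - slice \<Omega> S v p)"
    using u v by (rule Bochner_Integration.integrable_diff)
  then have int: "integrable (M \<Otimes>\<^sub>M M) (\<lambda>(x, y). indicator \<Omega> y * (indicator S x * g x y))"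
    by (rule Bochner_Integration.integrable_cong[THEN iffD1, rotated -1]) (auto simp: g)
  have inner: "AE y in M. y \<in> \<Omega> \<longrightarrow> ext_set_integral M S (\<lambda>x. f x y) = ereal (\<integral>x. indicator S x * g x y \<partial>M)"
    using AE_integrable_snd[OF int] P
  proof eventually_elim
    case (elim y)
    show ?case
    proof
      assume "y \<in> \<Omega>"
      with elim have "integrable M (\<lambda>x. indicator S x * g x y)"
        by simp
      moreover have "AE x in M. x \<in> S \<longrightarrow> f x y = ereal (g x y)"
        using P by eventually_elim (use elim f in \<open>simp add: g_def\<close>)
      ultimately show "ext_set_integral M S (\<lambda>x. f x y) = ereal (\<integral>x. indicator S x * g x y \<partial>M)"
        by (intro ext_set_integral_eq) auto
    qed
  qed
  have "ext_set_integral M \<Omega> (\<lambda>y. ext_set_integral M S (\<lambda>x. f x y)) =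
      ereal (\<integral>y. indicator \<Omega> y * (\<integral>x. indicator S x * g x y \<partial>M) \<partial>M)"
    using integrable_snd[OF int] by (intro ext_set_integral_eq inner) simp_all
  also have "(\<integral>y. indicator \<Omega> y * (\<integral>x. indicator S x * g x y \<partial>M) \<partial>M) =
      (\<integral>p. (case p of (x, y) \<Rightarrow> indicator \<Omega> y * (indicator S x * g x y)) \<partial>(M \<Otimes>\<^sub>M M))"
    using integral_snd[OF int] by simp
  also have "\<dots> = (\<integral>p. slice \<Omega> S u p - slice \<Omega> S v p \<partial>(M \<Otimes>\<^sub>M M))"
    by (intro Bochner_Integration.integral_cong) (auto simp: g)
  also have "\<dots> = (\<integral>p. slice \<Omega> S u p \<partial>(M \<Otimes>\<^sub>M M)) - (\<integral>p. slice \<Omega> S v p \<partial>(M \<Otimes>\<^sub>M M))"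
    using u v by (rule Bochner_Integration.integral_diff)
  finally show ?thesis .
qed

text \<open>After a correction of \<open>\<eta>\<close> on a null set, \<open>v = u + \<eta>\<close>
  is a competitor above \<open>u\<close>, and the functional equals the energy of \<open>u\<close>
  minus that of \<open>v\<close>. Both energies are finite, so minimality gives the sign.\<close>

lemma superminimizerI:
  assumes \<Omega> [measurable]: "\<Omega> \<in> sets M" and u [measurable]: "u \<in> borel_measurable M"
    and u\<Omega>: "\<And>y. y \<notin> \<Omega> \<Longrightarrow> u y = 0" and fin: "energy (super_weight \<Omega>) u < top"
    and min: "\<And>v. v \<in> borel_measurable M \<Longrightarrow> (\<And>y. u y \<le> v y) \<Longrightarrow> (\<And>y. y \<notin> \<Omega> \<Longrightarrow> v y = 0)
      \<Longrightarrow> energy (super_weight \<Omega>) u \<le> energy (super_weight \<Omega>) v"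
  shows "superminimizer \<mu> s \<Omega> (\<lambda>x. ereal (u x))"
  unfolding superminimizer_def
proof (intro conjI ballI impI)
  let ?u = "\<lambda>x. ereal (u x)"
  show "?u \<in> borel_measurable M"
    by measurable
  have "frac_seminorm \<mu> s \<Omega> ?u \<le> energy (super_weight \<Omega>) u"
    unfolding frac_seminorm_def energy_eq_iterated[OF u super_weight_measurable[OF \<Omega>]]
  proof (rule nn_integral_mono)
    fix y
    show "(\<integral>\<^sup>+x\<in>\<Omega>. (e2ennreal \<bar>?u x - ?u y\<bar> / frac_weight \<mu> s x y) \<partial>M) * indicator \<Omega> y \<le>
        (\<integral>\<^sup>+x. super_weight \<Omega> (x, y) * ennreal \<bar>u x - u y\<bar> \<partial>M)"
      by (cases "y \<in> \<Omega>")
        (auto intro!: nn_integral_mono split: split_indicator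
          simp: super_weight_def kern_eq divide_ennreal_def e2ennreal_ereal mult.commute)
  qed
  then show "?u \<in> frac_hom_sobolev \<mu> s \<Omega>"
    using fin by (auto simp: frac_hom_sobolev_def intro!: measurable_ereal_restrict_UNIV)
  fix \<eta> :: "'a \<Rightarrow> ereal"
  assume \<eta>: "\<eta> \<in> frac_sobolev_zero \<mu> s \<Omega>" and nonneg: "\<forall>x. 0 \<le> \<eta> x"
  have "\<eta> \<in> borel_measurable (restrict_space M UNIV)" and norm: "frac_norm \<mu> s UNIV \<eta> < \<infinity>"
    using \<eta> by (simp_all add: frac_sobolev_zero_def frac_sobolev_def)
  then have [measurable]: "\<eta> \<in> borel_measurable M"
    by (simp only: measurable_cong_sets[OF sets_restrict_UNIV refl])
  have AE0: "AE y in M. y \<notin> \<Omega> \<longrightarrow> \<eta> y = 0"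
    using \<eta> by (simp add: frac_sobolev_zero_def)
  have AEfin: "AE y in M. \<bar>\<eta> y\<bar> \<noteq> \<infinity>"
  proof -
    have "(\<integral>\<^sup>+y. e2ennreal \<bar>\<eta> y\<bar> \<partial>M) \<noteq> \<infinity>"
      using norm by (auto simp: frac_norm_def)
    then have "AE y in M. e2ennreal \<bar>\<eta> y\<bar> \<noteq> \<infinity>"
      by (intro nn_integral_PInf_AE) auto
    then show ?thesis
      by eventually_elim (auto simp: e2ennreal_infty)
  qed
  \<comment> \<open>\<open>e'\<close> removes infinite values; \<open>e\<close> also vanishes at
    every point outside \<open>\<Omega>\<close>, not just almost every one, as the minimality
    hypothesis asks.\<close>
  define e' where "e' y = real_of_ereal (\<eta> y)" for y
  define e where "e y = (if y \<in> \<Omega> then e' y else 0)" for y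
  have [measurable]: "e' \<in> borel_measurable M"
    unfolding e'_def by measurable
  have e_meas [measurable]: "e \<in> borel_measurable M"
    unfolding e_def by measurable
  have e_nonneg: "0 \<le> e y" for y
    using nonneg by (simp add: e_def e'_def real_of_ereal_pos)
  have P: "AE y in M. \<eta> y = ereal (e y)"
    using AE0 AEfin by eventually_elim (auto simp: e_def e'_def ereal_real')
  have "energy kern e = energy kern e'"
    using AE0 by (intro energy_cong_AE) (auto simp: e_def e'_def)
  also have "\<dots> \<le> frac_seminorm \<mu> s UNIV \<eta>"
  proof (rule energy_le_frac_seminorm)
    show "ennreal \<bar>e' x - e' y\<bar> \<le> e2ennreal \<bar>\<eta> x - \<eta> y\<bar>" for x y
      unfolding e'_def by (cases "\<eta> x"; cases "\<eta> y") (auto simp: e2ennreal_ereal e2ennreal_infty)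
  qed measurable
  also have "\<dots> < top"
    using norm by (simp add: frac_norm_def)
  finally have e_fin: "energy kern e < top" .
  define v where "v y = u y + e y" for y
  have v [measurable]: "v \<in> borel_measurable M"
    unfolding v_def by measurable
  have "energy (super_weight \<Omega>) v \<le> energy (super_weight \<Omega>) u + energy (super_weight \<Omega>) e"
    unfolding v_def by (intro energy_add_le) measurable
  also have "\<dots> \<le> energy (super_weight \<Omega>) u + 2 * energy kern e"
    by (intro add_left_mono energy_super_weight_le) measurable
  also have "\<dots> < top"
    using fin e_fin by (simp add: ennreal_mult_less_top)
  finally have v_fin: "energy (super_weight \<Omega>) v < top" .
  have le: "energy (super_weight \<Omega>) u \<le> energy (super_weight \<Omega>) v"
    using e_nonneg u\<Omega> by (intro min) (auto simp: v_def e_def)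
  have [measurable]: "- \<Omega> \<in> sets M"
    using sets.compl_sets[of \<Omega> M] by (simp add: Compl_eq_Diff_UNIV)
  define f where "f x y = (\<bar>?u x - ?u y\<bar> - \<bar>(?u x + \<eta> x) - (?u y + \<eta> y)\<bar>) / enn2ereal (frac_weight \<mu> s x y)" for x y
  have f: "f x y = ereal ((\<bar>u x - u y\<bar> - \<bar>v x - v y\<bar>) / enn2real (frac_weight \<mu> s x y))"
    if "\<eta> x = ereal (e x)" "\<eta> y = ereal (e y)" for x y
  proof (cases "x = y")
    case True
    then show ?thesis
      using that by (simp add: f_def zero_ereal_def[symmetric])
  next
    case False
    have "frac_weight \<mu> s x y \<noteq> 0" "frac_weight \<mu> s x y \<noteq> top"
      using weight_bounds[OF False] by (simp_all add: frac_weight_eq)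
    then obtain w where "0 < w" "frac_weight \<mu> s x y = ennreal w"
      by (cases "frac_weight \<mu> s x y") (auto simp: order_le_less)
    then show ?thesis
      using that by (simp add: f_def v_def enn2ereal_ennreal)
  qed
  note iu = slice_energy[OF \<Omega> u fin] and iv = slice_energy[OF \<Omega> v v_fin]
  have "frac_functional \<mu> s \<Omega> ?u (\<lambda>x. ?u x + \<eta> x) =
      ext_set_integral M \<Omega> (\<lambda>y. ext_set_integral M \<Omega> (\<lambda>x. f x y)) +
      2 * ext_set_integral M \<Omega> (\<lambda>y. ext_set_integral M (- \<Omega>) (\<lambda>x. f x y))"
    by (simp add: frac_functional_def Let_def f_def)
  also have "\<dots> = ereal ((\<integral>p. slice \<Omega> \<Omega> u p \<partial>(M \<Otimes>\<^sub>M M)) - (\<integral>p. slice \<Omega> \<Omega> v p \<partial>(M \<Otimes>\<^sub>M M))) +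
      2 * ereal ((\<integral>p. slice \<Omega> (- \<Omega>) u p \<partial>(M \<Otimes>\<^sub>M M)) - (\<integral>p. slice \<Omega> (- \<Omega>) v p \<partial>(M \<Otimes>\<^sub>M M)))"
    using iu iv P f by (intro arg_cong2[where f = "\<lambda>a b. a + 2 * b"] ext_set_integral_slices[where P = "\<lambda>y. \<eta> y = ereal (e y)"]) auto
  also have "\<dots> = ereal (((\<integral>p. slice \<Omega> \<Omega> u p \<partial>(M \<Otimes>\<^sub>M M)) + 2 * (\<integral>p. slice \<Omega> (- \<Omega>) u p \<partial>(M \<Otimes>\<^sub>M M))) -
      ((\<integral>p. slice \<Omega> \<Omega> v p \<partial>(M \<Otimes>\<^sub>M M)) + 2 * (\<integral>p. slice \<Omega> (- \<Omega>) v p \<partial>(M \<Otimes>\<^sub>M M))))"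
    by (simp add: algebra_simps)
  also have "\<dots> \<le> ereal 0"
    using le unfolding iu(3) iv(3)
    by (subst (asm) ennreal_le_iff) (auto intro!: add_nonneg_nonneg integral_nonneg_AE simp: slice_nonneg)
  finally show "frac_functional \<mu> s \<Omega> ?u (\<lambda>x. ?u x + \<eta> x) \<le> 0"
    unfolding zero_ereal_def .
qed

section \<open>Superminimizers exploding along a thin set\<close>

lemma energy_kern_restrict_le: "energy (\<lambda>p. kern p * indicator B (snd p)) v \<le> energy kern v"
  unfolding energy_def by (intro nn_integral_mono) (auto split: split_indicator)

text \<open>The infimum \<open>q\<close> of the mass of the ball over \<open>t powr s\<close>, for
  \<open>t\<close> up to \<open>R\<close>, is positive by \<open>m\<close>, and some
  \<open>t0\<close> has a ratio below \<open>2 * q\<close>. The choice \<open>r = t0 / 2\<close>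
  makes the lower bound valid up to radius \<open>2 * r\<close>, that of the ball supporting the
  condenser test functions. Halving costs \<open>2 powr s \<le> 2\<close>, hence the 4.\<close>

lemma ex_almost_minimal_radius:
  assumes m: "0 < m" "\<And>r. 0 < r \<Longrightarrow> r \<le> R \<Longrightarrow> ennreal (m * r powr s) \<le> emeasure M (ball x0 r)" and R: "0 < R"
  obtains r q where "0 < r" "2 * r \<le> R" "0 < q" "emeasure M (ball x0 r) \<le> ennreal (4 * q * r powr s)"
    "\<And>t. 0 < t \<Longrightarrow> t \<le> 2 * r \<Longrightarrow> ennreal (q * t powr s) \<le> emeasure M (ball x0 t)"
proof -
  define \<phi> where "\<phi> t = measure M (ball x0 t) * t powr - s" for t
  have em: "emeasure M (ball x0 t) = ennreal (\<phi> t * t powr s)" if "0 < t" for t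
  proof -
    have "emeasure M (ball x0 t) = ennreal (measure M (ball x0 t))"
      using emeasure_ball_finite[OF that, of x0] by (intro emeasure_eq_ennreal_measure) auto
    then show ?thesis
      using that by (simp add: \<phi>_def powr_minus)
  qed
  have \<phi>_ge: "m \<le> \<phi> t" if "0 < t" "t \<le> R" for t
  proof -
    have "ennreal (m * t powr s) \<le> ennreal (\<phi> t * t powr s)"
      using m(2)[OF that] em[OF that(1)] by simp
    then have "m * t powr s \<le> \<phi> t * t powr s"
      by (subst (asm) ennreal_le_iff) (auto simp: \<phi>_def)
    then show ?thesis
      using that by simp
  qed
  define q where "q = (INF t\<in>{0<..R}. \<phi> t)"
  have bdd: "bdd_below (\<phi> ` {0<..R})"
    using \<phi>_ge by (intro bdd_belowI[of _ m]) auto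
  have "m \<le> q"
    unfolding q_def using \<phi>_ge R by (intro cINF_greatest) auto
  with m(1) have q: "0 < q"
    by simp
  have "q < 2 * q"
    using q by simp
  then obtain t0 where t0: "0 < t0" "t0 \<le> R" "\<phi> t0 < 2 * q"
    using cINF_less_iff[of "{0<..R}" \<phi> "2 * q"] bdd R by (auto simp: q_def)
  show thesis
  proof (rule that[of "t0 / 2" q])
    have "emeasure M (ball x0 (t0 / 2)) \<le> emeasure M (ball x0 t0)"
      using t0 by (intro emeasure_mono subset_ball) auto
    also have "\<dots> \<le> ennreal (4 * q * (t0 / 2) powr s)"
      unfolding em[OF t0(1)]
    proof (rule ennreal_leI)
      have "t0 powr s = 2 powr s * (t0 / 2) powr s"
        using t0 by (simp flip: powr_mult)
      also have "\<dots> \<le> 2 powr 1 * (t0 / 2) powr s"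
        using s_less_1 by (intro mult_right_mono powr_mono) auto
      finally have "\<phi> t0 * t0 powr s \<le> (2 * q) * (2 * (t0 / 2) powr s)"
        using t0 q by (intro mult_mono) auto
      then show "\<phi> t0 * t0 powr s \<le> 4 * q * (t0 / 2) powr s"
        by (simp add: algebra_simps)
    qed
    finally show "emeasure M (ball x0 (t0 / 2)) \<le> ennreal (4 * q * (t0 / 2) powr s)" .
    fix t assume t: "0 < t" "t \<le> 2 * (t0 / 2)"
    have "q \<le> \<phi> t"
      unfolding q_def using t t0 by (intro cINF_lower bdd) auto
    then show "ennreal (q * t powr s) \<le> emeasure M (ball x0 t)"
      unfolding em[OF t(1)] by (intro ennreal_leI mult_right_mono) auto
  qed (use t0 q in auto)
qed

lemma thin_hardy_function:
  assumes conn: "connected (UNIV :: 'a set)" and cap: "0 < frac_capacity \<mu> s {x0}"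
    and thin: "frac_thin \<mu> s A x0" and R: "0 < R" and far: "2 * R \<le> dist x0 z"
  obtains r U w where "0 < r" "open U" "A \<inter> ball x0 r \<subseteq> U"
    "w \<in> borel_measurable M" "\<And>y. 0 \<le> w y" "w x0 = 0" "\<And>y. y \<notin> ball x0 R \<Longrightarrow> w y = 0"
    "\<And>y. y \<in> U \<Longrightarrow> y \<noteq> x0 \<Longrightarrow> w y = 1" "energy kern w < top"
    "(\<integral>\<^sup>+y. ennreal (dist x0 y powr - s) * ennreal (w y) \<partial>M) < top"
proof -
  \<comment> \<open>The test function will have energy below
    \<open>4 * \<epsilon> * cutoff_const * q\<close>, and the Hardy factor is
    \<open>3 * C ^ 9 / q\<close>. Their product is \<open>1 / 8\<close>, whatever \<open>q\<close>
    is, which is below the level \<open>1 / 4\<close>. Level and margin \<open>1 / 4\<close> then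
    add up to \<open>1 / 2\<close>.\<close>
  define \<epsilon> where "\<epsilon> = 1 / (96 * C ^ 9 * cutoff_const)"
  have \<epsilon>: "0 < \<epsilon>"
    using C_ge_1 cutoff_const_pos by (simp add: \<epsilon>_def)
  let ?cap = "\<lambda>r. condenser_capacity \<mu> s (A \<inter> ball x0 r) (ball x0 (2 * r))"
  let ?cap' = "\<lambda>r. condenser_capacity \<mu> s (ball x0 r) (ball x0 (2 * r))"
  have "eventually (\<lambda>r. ?cap r / ?cap' r < ennreal (\<epsilon> / 2)) (at_right 0)"
    using thin \<epsilon> unfolding frac_thin_def by (intro order_tendstoD(2)) auto
  then obtain r0 where r0: "0 < r0" "\<And>r. 0 < r \<Longrightarrow> r < r0 \<Longrightarrow> ?cap r / ?cap' r < ennreal (\<epsilon> / 2)"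
    unfolding eventually_at_right_field by auto
  define R' where "R' = min R r0"
  have R': "0 < R'" "R' \<le> R" "R' \<le> r0"
    using R r0 by (auto simp: R'_def)
  obtain m where m: "0 < m" "\<And>r. 0 < r \<Longrightarrow> r \<le> R' \<Longrightarrow> ennreal (m * r powr s) \<le> emeasure M (ball x0 r)"
    using emeasure_ball_lower_bound[OF cap R'(1)] by blast
  obtain r q where r: "0 < r" "2 * r \<le> R'" and q: "0 < q" "emeasure M (ball x0 r) \<le> ennreal (4 * q * r powr s)"
    and lower: "\<And>t. 0 < t \<Longrightarrow> t \<le> 2 * r \<Longrightarrow> ennreal (q * t powr s) \<le> emeasure M (ball x0 t)"
    using ex_almost_minimal_radius[OF m R'(1)] by blast
  have cap'_le: "?cap' r \<le> ennreal (4 * cutoff_const * q)"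
  proof -
    have "?cap' r \<le> ennreal (cutoff_const * r powr - s) * emeasure M (ball x0 r)"
      by (rule condenser_capacity_ball_le[OF r(1)])
    also have "\<dots> \<le> ennreal (cutoff_const * r powr - s) * ennreal (4 * q * r powr s)"
      by (intro mult_left_mono q) auto
    also have "\<dots> = ennreal (cutoff_const * r powr - s * (4 * q * r powr s))"
      using cutoff_const_pos q by (simp flip: ennreal_mult)
    also have "cutoff_const * r powr - s * (4 * q * r powr s) = 4 * cutoff_const * q"
      using r by (simp add: powr_minus field_simps)
    finally show ?thesis .
  qed
  have "?cap r \<le> ennreal (\<epsilon> / 2) * ?cap' r"
    using r R' r0 by (intro ennreal_divide_less_imp_le le_less_trans[OF cap'_le]) auto
  also have "\<dots> \<le> ennreal (\<epsilon> / 2) * ennreal (4 * cutoff_const * q)"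
    by (intro mult_left_mono cap'_le) auto
  also have "\<dots> = ennreal (2 * \<epsilon> * cutoff_const * q)"
    using \<epsilon> cutoff_const_pos q by (simp flip: ennreal_mult)
  \<comment> \<open>The capacity is an infimum, so a strict bound is what produces a test
    function.\<close>
  also have "\<dots> < ennreal (4 * \<epsilon> * cutoff_const * q)"
    using \<epsilon> cutoff_const_pos q by (intro ennreal_lessI) auto
  finally obtain v U where v [measurable]: "v \<in> borel_measurable M" and v01: "\<And>y. 0 \<le> v y" "\<And>y. v y \<le> 1"
    and v0: "\<And>y. y \<notin> ball x0 (2 * r) \<Longrightarrow> v y = 0" and U: "open U" "A \<inter> ball x0 r \<subseteq> U" "\<And>y. y \<in> U \<Longrightarrow> v y = 1"
    and v_energy: "energy kern v < ennreal (4 * \<epsilon> * cutoff_const * q)"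
    using condenser_test_function by metis
  have "(\<integral>\<^sup>+y. ennreal (dist x0 y powr - s) * indicator {y. 1 / 4 + 1 / 4 < v y} y \<partial>M)
      \<le> ennreal (6 * C ^ 6 / (1 / 4)) * energy kern v"
  proof (rule superlevel_hardy[OF conn _ _ q(1) lower v v01(1) v0 energy_kern_restrict_le])
    show "3 / 2 * (2 * r) \<le> dist x0 z"
      using r R' far by simp
    have "ennreal (3 * C ^ 9 / q) * energy kern v \<le> ennreal (3 * C ^ 9 / q) * ennreal (4 * \<epsilon> * cutoff_const * q)"
      using v_energy by (intro mult_left_mono) auto
    also have "\<dots> = ennreal (3 * C ^ 9 / q * (4 * \<epsilon> * cutoff_const * q))"
      using C_ge_1 q \<epsilon> cutoff_const_pos by (simp flip: ennreal_mult)
    also have "\<dots> \<le> ennreal (1 / 4)"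
      using C_ge_1 q cutoff_const_pos by (intro ennreal_leI) (simp add: \<epsilon>_def field_simps)
    finally show "ennreal (3 * C ^ 9 / q) * energy kern v \<le> ennreal (1 / 4)" .
  qed (use r in auto)
  also have "\<dots> < top"
    using v_energy by (auto simp: ennreal_mult_less_top intro: less_trans)
  finally have hardy: "(\<integral>\<^sup>+y. ennreal (dist x0 y powr - s) * indicator {y. 1 / 4 + 1 / 4 < v y} y \<partial>M) < top" .
  define w' where "w' y = max 0 (2 * v y - 1)" for y
  \<comment> \<open>\<open>U\<close> may contain \<open>x0\<close>, where no cutoff becomes small;
    setting \<open>w\<close> to 0 at this null point leaves the energy unchanged.\<close>
  define w where "w y = indicator (- {x0}) y * w' y" for y
  have [measurable]: "w' \<in> borel_measurable M"
    unfolding w'_def by measurable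
  have [measurable]: "- {x0} \<in> sets M"
    by (intro open_in_sets) auto
  have w_meas: "w \<in> borel_measurable M"
    unfolding w_def by measurable
  have "energy kern w = energy kern w'"
  proof (rule energy_cong_AE)
    have "z \<noteq> x0"
      using R far by auto
    then have "emeasure M {x0} = 0"
      by (rule emeasure_singleton_eq_0[OF conn])
    then show "AE y in M. w y = w' y"
      by (intro AE_I[of _ _ "{x0}"]) (auto simp: w_def indicator_def intro!: closed_in_sets)
  qed
  also have "\<dots> \<le> (\<integral>\<^sup>+p. 2 * (kern p * ennreal \<bar>v (fst p) - v (snd p)\<bar>) \<partial>(M \<Otimes>\<^sub>M M))"
    unfolding energy_def
  proof (rule nn_integral_mono)
    fix p
    have clamp: "\<bar>max 0 (2 * a - 1) - max 0 (2 * b - 1)\<bar> \<le> 2 * \<bar>a - b\<bar>" for a b :: real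
      by (auto simp: max_def abs_if)
    have "kern p * ennreal \<bar>w' (fst p) - w' (snd p)\<bar> \<le> kern p * ennreal (2 * \<bar>v (fst p) - v (snd p)\<bar>)"
      unfolding w'_def by (intro mult_left_mono ennreal_leI clamp) auto
    also have "\<dots> = 2 * (kern p * ennreal \<bar>v (fst p) - v (snd p)\<bar>)"
      by (simp add: ennreal_mult ac_simps)
    finally show "kern p * ennreal \<bar>w' (fst p) - w' (snd p)\<bar> \<le> 2 * (kern p * ennreal \<bar>v (fst p) - v (snd p)\<bar>)" .
  qed
  also have "\<dots> = 2 * energy kern v"
    unfolding energy_def by (rule nn_integral_cmult) measurable
  also have "\<dots> < top"
    using v_energy by (auto simp: ennreal_mult_less_top intro: less_trans)
  finally have w_energy: "energy kern w < top" .
  have "(\<integral>\<^sup>+y. ennreal (dist x0 y powr - s) * ennreal (w y) \<partial>M) \<le>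
      (\<integral>\<^sup>+y. ennreal (dist x0 y powr - s) * indicator {y. 1 / 4 + 1 / 4 < v y} y \<partial>M)"
  proof (intro nn_integral_mono mult_left_mono)
    fix y
    show "ennreal (w y) \<le> indicator {y. 1 / 4 + 1 / 4 < v y} y"
      using v01(2)[of y] by (auto simp: w_def w'_def max_def ennreal_le_1 split: split_indicator)
  qed simp
  then have w_hardy: "(\<integral>\<^sup>+y. ennreal (dist x0 y powr - s) * ennreal (w y) \<partial>M) < top"
    using hardy by (rule le_less_trans)
  show thesis
  proof (rule that[OF r(1) U(1,2) w_meas _ _ _ _ w_energy w_hardy])
    show "w y = 0" if "y \<notin> ball x0 R" for y
      using v0[of y] that r R' by (simp add: w_def w'_def)
  qed (simp_all add: w_def w'_def U(3))
qed

text \<open>Off the diagonal the weight \<open>frac_weight\<close> is finite, so its reciprocal is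
  positive, and it is integrated over a set of positive mass. This supplies the hypothesis
  \<open>pos\<close> of \<open>energy_minimizer\<close>.\<close>

lemma super_weight_outside_pos:
  assumes \<Omega> [measurable]: "\<Omega> \<in> sets M" and pos: "emeasure M (- \<Omega>) \<noteq> 0" and y: "y \<in> \<Omega>"
  shows "0 < (\<integral>\<^sup>+x. indicator (- \<Omega>) x * super_weight \<Omega> (x, y) \<partial>M)"
proof (rule ccontr)
  have c [measurable]: "- \<Omega> \<in> sets M"
    using sets.compl_sets[of \<Omega> M] by (simp add: Compl_eq_Diff_UNIV)
  assume "\<not> ?thesis"
  then have "AE x in M. indicator (- \<Omega>) x * super_weight \<Omega> (x, y) = 0"
    by (subst (asm) not_gr_zero, subst (asm) nn_integral_0_iff_AE) auto
  then have "AE x in M. x \<notin> - \<Omega>"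
  proof eventually_elim
    case (elim x)
    show ?case
    proof
      assume x: "x \<in> - \<Omega>"
      with y have "x \<noteq> y"
        by auto
      then have "kern (x, y) \<noteq> 0"
        using weight_bounds(2)[of x y] by (simp add: kern_def)
      with elim x y show False
        by (simp add: super_weight_def)
    qed
  qed
  then have "emeasure M (- \<Omega>) = 0"
    using AE_iff_measurable[OF c, of "\<lambda>x. x \<notin> - \<Omega>"] by auto
  with pos show False ..
qed

lemma upper_approx_limit_le:
  assumes u [measurable]: "u \<in> borel_measurable M"
    and "((\<lambda>r. emeasure M ({y. t < u y} \<inter> ball x0 r) / emeasure M (ball x0 r)) \<longlongrightarrow> 0) (at_right 0)"
  shows "upper_approx_limit \<mu> (\<lambda>y. ereal (u y)) x0 \<le> ereal t"
proof -
  have S: "{y. t < u y} \<in> sets M"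
  proof -
    have "{y \<in> space M. t < u y} \<in> sets M"
      by measurable
    then show ?thesis
      by simp
  qed
  have "{y \<in> ball x0 r. ereal t < ereal (u y)} = {y. t < u y} \<inter> ball x0 r" for r
    by auto
  then have "\<mu> {y \<in> ball x0 r. ereal t < ereal (u y)} / \<mu> (ball x0 r) =
      emeasure M ({y. t < u y} \<inter> ball x0 r) / emeasure M (ball x0 r)" for r
    using S by (simp add: \<mu>_eq)
  with assms(2) show ?thesis
    unfolding upper_approx_limit_def by (intro Inf_lower imageI) simp
qed

lemma lower_approx_limit_ge:
  assumes V: "open V" "y \<in> V" and le: "\<And>z. z \<in> V \<Longrightarrow> t \<le> u z"
  shows "ereal t \<le> lower_approx_limit \<mu> (\<lambda>z. ereal (u z)) y"
proof -
  obtain d where d: "0 < d" "ball y d \<subseteq> V"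
    using V by (auto simp: open_contains_ball)
  have "eventually (\<lambda>r. r \<in> {0<..<d}) (at_right 0)"
    using d by (intro eventually_at_right_real)
  then have "eventually (\<lambda>r. \<mu> {z \<in> ball y r. ereal (u z) < ereal t} / \<mu> (ball y r) = 0) (at_right 0)"
  proof eventually_elim
    case (elim r)
    have empty: "{z \<in> ball y r. ereal (u z) < ereal t} = {}"
    proof -
      have "ball y r \<subseteq> V"
        using elim d(2) subset_ball[of r d y] by auto
      with le show ?thesis
        by (auto simp: not_less)
    qed
    show ?case
      unfolding empty by (simp add: \<mu>_eq)
  qed
  then show ?thesis
    unfolding lower_approx_limit_def by (intro Sup_upper imageI) (simp add: tendsto_eventually)
qed

lemma ex_exploding_superminimizer:
  assumes conn: "connected (UNIV :: 'a set)" and cap: "0 < frac_capacity \<mu> s {x0}"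
    and thin: "frac_thin \<mu> s A x0" and R: "0 < R" and far: "2 * R \<le> dist x0 z"
  shows "\<exists>u. superminimizer \<mu> s (ball x0 R) u \<and> (lower_approx_limit \<mu> u \<longlongrightarrow> \<infinity>) (at x0 within A) \<and>
    upper_approx_limit \<mu> u x0 < \<infinity>"
proof -
  let ?\<Omega> = "ball x0 R"
  let ?W = "super_weight ?\<Omega>"
  obtain w U r where r: "0 < r" and U: "open U" "A \<inter> ball x0 r \<subseteq> U"
    and w: "w \<in> borel_measurable M" "\<And>y. 0 \<le> w y" "w x0 = 0" and w\<Omega>: "\<And>y. y \<notin> ?\<Omega> \<Longrightarrow> w y = 0"
    and w1: "\<And>y. y \<in> U \<Longrightarrow> y \<noteq> x0 \<Longrightarrow> w y = 1" and w2: "energy kern w < top"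
    "(\<integral>\<^sup>+y. ennreal (dist x0 y powr - s) * ennreal (w y) \<partial>M) < top"
    by (rule thin_hardy_function[OF conn cap thin R far]) (rule that; simp)
  obtain \<psi> where \<psi>: "\<psi> \<in> borel_measurable M" "\<And>y. 0 \<le> \<psi> y" "\<And>y. w y = 0 \<Longrightarrow> \<psi> y = 0" "energy kern \<psi> < top"
    and \<psi>_large: "\<And>k::nat. \<exists>\<delta>>0. \<forall>y. w y = 1 \<longrightarrow> dist x0 y < \<delta> \<longrightarrow> real k \<le> \<psi> y"
    using exploding_function[OF w w2] by metis
  have "emeasure M (- ?\<Omega>) \<noteq> 0"
  proof -
    have "ball z R \<subseteq> - ?\<Omega>"
    proof
      fix y assume "y \<in> ball z R"
      then show "y \<in> - ?\<Omega>"
        using far dist_triangle[of x0 z y] by (simp add: dist_commute)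
    qed
    then have "emeasure M (ball z R) \<le> emeasure M (- ?\<Omega>)"
      by (intro emeasure_mono closed_in_sets) (auto simp: closed_Compl)
    then show ?thesis
      using emeasure_ball_pos[OF R, of z] by auto
  qed
  then have pos: "0 < (\<integral>\<^sup>+x. indicator (- ?\<Omega>) x * ?W (x, y) \<partial>M)" if "y \<in> ?\<Omega>" for y
    using that by (intro super_weight_outside_pos) auto
  have "energy ?W \<psi> \<le> 2 * energy kern \<psi>"
    using \<psi>(1) by (intro energy_super_weight_le) auto
  also have "\<dots> < top"
    using \<psi>(4) by (simp add: ennreal_mult_less_top)
  finally have \<psi>_energy: "energy ?W \<psi> < top" .
  obtain u where u [measurable]: "u \<in> borel_measurable M" and \<psi>u: "\<And>y. \<psi> y \<le> u y"
    and u\<Omega>: "\<And>y. y \<notin> ?\<Omega> \<Longrightarrow> u y = 0" and u_fin: "energy ?W u < top"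
    and min: "\<And>v. v \<in> borel_measurable M \<Longrightarrow> (\<And>y. \<psi> y \<le> v y) \<Longrightarrow> (\<And>y. y \<notin> ?\<Omega> \<Longrightarrow> v y = 0)
      \<Longrightarrow> energy ?W u \<le> energy ?W v"
  proof (rule energy_minimizer[of ?W ?\<Omega> \<psi>], goal_cases)
    case (9 u)
    show ?case
      by (rule 9(1)[OF 9(2-)])
  qed (use \<psi> w\<Omega> \<psi>_energy pos in \<open>auto simp: super_weight_finite\<close>)
  have "superminimizer \<mu> s ?\<Omega> (\<lambda>x. ereal (u x))"
  proof (rule superminimizerI[OF _ u u\<Omega> u_fin])
    show "energy ?W u \<le> energy ?W v" if "v \<in> borel_measurable M" "\<And>y. u y \<le> v y" "\<And>y. y \<notin> ?\<Omega> \<Longrightarrow> v y = 0" for v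
      using that(1) order_trans[OF \<psi>u that(2)] that(3) by (rule min)
  qed auto
  moreover have "(lower_approx_limit \<mu> (\<lambda>x. ereal (u x)) \<longlongrightarrow> \<infinity>) (at x0 within A)"
    unfolding tendsto_PInfty
  proof
    fix a :: real
    obtain k :: nat where k: "a < real k"
      using reals_Archimedean2 by blast
    obtain \<delta> where \<delta>: "0 < \<delta>" "\<And>y. w y = 1 \<Longrightarrow> dist x0 y < \<delta> \<Longrightarrow> real k \<le> \<psi> y"
      using \<psi>_large by blast
    have "eventually (\<lambda>y. y \<in> A \<and> y \<noteq> x0 \<and> dist y x0 < min r \<delta>) (at x0 within A)"
      using r \<delta>(1) unfolding eventually_at by (intro exI[of _ "min r \<delta>"]) auto
    then show "eventually (\<lambda>y. ereal a < lower_approx_limit \<mu> (\<lambda>x. ereal (u x)) y) (at x0 within A)"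
    proof eventually_elim
      case (elim y)
      \<comment> \<open>An open neighbourhood of \<open>y\<close> on which \<open>w\<close> is 1 and
        the obstacle is at least \<open>k\<close> at every point; openness turns this pointwise
        bound into one for the lower approximate limit.\<close>
      define V where "V = (U - {x0}) \<inter> ball x0 \<delta>"
      have "ereal (real k) \<le> lower_approx_limit \<mu> (\<lambda>x. ereal (u x)) y"
      proof (rule lower_approx_limit_ge[of V])
        show "open V"
          using U by (auto simp: V_def)
        show "y \<in> V"
          using elim U(2) by (auto simp: V_def dist_commute)
        show "real k \<le> u z" if "z \<in> V" for z
          using that \<delta>(2)[of z] w1[of z] \<psi>u[of z] by (auto simp: V_def)
      qed
      with k show ?case
        by (meson less_ereal.simps(1) less_le_trans)
    qed
  qed
  moreover have "upper_approx_limit \<mu> (\<lambda>x. ereal (u x)) x0 < \<infinity>"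
  proof -
    obtain m where m: "0 < m" and lower: "\<And>r. 0 < r \<Longrightarrow> r \<le> R \<Longrightarrow> ennreal (m * r powr s) \<le> emeasure M (ball x0 r)"
      using emeasure_ball_lower_bound[OF cap R] by blast
    define I where "I = energy (\<lambda>p. kern p * indicator ?\<Omega> (snd p)) u"
    \<comment> \<open>For second points in the domain the weight is at least
      \<open>kern\<close>.\<close>
    have "I \<le> energy ?W u"
      unfolding I_def energy_def super_weight_def
      by (intro nn_integral_mono mult_right_mono mult_left_mono) (auto split: split_indicator)
    with u_fin have I: "I < top"
      by simp
    define L where "L = enn2real (ennreal (3 * C ^ 9 / m) * I)"
    have L: "ennreal (3 * C ^ 9 / m) * I \<le> ennreal L"
      using I by (simp add: L_def ennreal_mult_less_top)
    have "(\<integral>\<^sup>+y. ennreal (dist x0 y powr - s) * indicator {y. L + 1 < u y} y \<partial>M) \<le> ennreal (6 * C ^ 6 / 1) * I"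
    proof (rule superlevel_hardy[OF conn R _ m lower u _ u\<Omega> _ _ L])
      show "3 / 2 * R \<le> dist x0 z"
        using R far by simp
      show "0 \<le> u y" for y
        using \<psi>(2) \<psi>u by (rule order_trans)
    qed (auto simp: I_def L_def)
    also have "\<dots> < top"
      using I by (simp add: ennreal_mult_less_top)
    finally have fin: "(\<integral>\<^sup>+y. ennreal (dist x0 y powr - s) * indicator {y. L + 1 < u y} y \<partial>M) < top" .
    have "{y \<in> space M. L + 1 < u y} \<in> sets M"
      by measurable
    then have S: "{y. L + 1 < u y} \<in> sets M"
      by simp
    have "z \<noteq> x0"
      using R far by auto
    then have "upper_approx_limit \<mu> (\<lambda>x. ereal (u x)) x0 \<le> ereal (L + 1)"
      by (intro upper_approx_limit_le[OF u] density_zero[OF S R m lower _ fin] emeasure_singleton_eq_0[OF conn])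
    also have "\<dots> < \<infinity>"
      by simp
    finally show ?thesis .
  qed
  ultimately show ?thesis
    by blast
qed

end

theorem theorem1p4:
  fixes \<mu> :: "'a::polish_space set \<Rightarrow> ennreal"
    and s :: real and A :: "'a set" and x :: 'a
  assumes "borel_regular_outer_measure \<mu>"
    and "locally_finite_measure \<mu>"
    and "doubling_measure \<mu>"
    and "connected (UNIV :: 'a set)"
    and "0 < s" and "s < 1"
    and "x \<in> closure A - A"
    and "frac_thin \<mu> s A x"
    and "frac_capacity \<mu> s {x} > 0"
  shows "\<forall>R0::real. 0 < R0 \<and> ereal R0 < ediameter (UNIV :: 'a set) / 4 \<longrightarrow>
           (\<exists>u. superminimizer \<mu> s (ball x R0) u \<and>
                (lower_approx_limit \<mu> u \<longlongrightarrow> \<infinity>) (at x within A) \<and>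
                upper_approx_limit \<mu> u x < \<infinity>)"
proof (intro allI impI)
  fix R0 :: real
  assume R0: "0 < R0 \<and> ereal R0 < ediameter (UNIV :: 'a set) / 4"
  have outer: "outer_measure_space UNIV \<mu>" and borel: "sets borel \<subseteq> lambda_system UNIV UNIV \<mu>"
    using assms(1) by (auto simp: borel_regular_outer_measure_def)
  obtain C where C: "\<And>y r. 0 < r \<Longrightarrow> 0 < \<mu> (ball y r) \<and> \<mu> (ball y r) < \<infinity> \<and> \<mu> (ball y (2 * r)) \<le> ennreal C * \<mu> (ball y r)"
    using assms(3) unfolding doubling_measure_def by blast
  have \<mu>: "emeasure (induced_measure \<mu>) (ball y r) = \<mu> (ball y r)" for y r
    using borel by (intro emeasure_induced_measure[OF outer]) auto
  \<comment> \<open>The maximum with 1 provides the normalization \<open>1 \<le> C\<close>.\<close>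
  interpret fractional_space \<mu> "max C 1" s
  proof
    fix y :: 'a and r :: real assume "0 < r"
    note * = C[OF this, of y]
    show "emeasure (induced_measure \<mu>) (ball y (2 * r)) \<le> ennreal (max C 1) * emeasure (induced_measure \<mu>) (ball y r)"
      unfolding \<mu> using * by (intro order_trans[OF conjunct2[OF conjunct2[OF *]]] mult_right_mono ennreal_leI) auto
    show "0 < emeasure (induced_measure \<mu>) (ball y r)" "emeasure (induced_measure \<mu>) (ball y r) < top"
      unfolding \<mu> using * by auto
  qed (use assms outer borel in \<open>auto simp: sets_induced_measure\<close>)
  \<comment> \<open>Two points farther apart than \<open>4 * R0\<close> leave one at distance at
    least \<open>2 * R0\<close> from \<open>x\<close>. This point guarantees both that the annuli
    around \<open>x\<close> are inhabited and that the complement of the ball has positive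
    mass.\<close>
  have "ereal (4 * R0) < ediameter (UNIV :: 'a set)"
    using R0 by (cases "ediameter (UNIV :: 'a set)") auto
  then obtain a b :: 'a where ab: "4 * R0 < dist a b"
    unfolding ediameter_def less_SUP_iff by auto
  have "2 * R0 \<le> dist x a \<or> 2 * R0 \<le> dist x b"
    using ab dist_triangle[of a b x] by (auto simp: dist_commute)
  then obtain z where "2 * R0 \<le> dist x z"
    by blast
  then show "\<exists>u. superminimizer \<mu> s (ball x R0) u \<and> (lower_approx_limit \<mu> u \<longlongrightarrow> \<infinity>) (at x within A) \<and>
      upper_approx_limit \<mu> u x < \<infinity>"
    using assms R0 by (intro ex_exploding_superminimizer) auto
qed

end
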